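(* Fix $k\in\mathbb{N}$ and $\beta\in(0,\infty)$, and let $\alpha=\beta\sqrt{n}$. For a $k$-out map $M$ on $[n]$ with in-degrees $D_1(M),\dots,D_n(M)$, let $X(M)=\sum_{i=1}^n D_i(M)^2$. Then $$\lim_{n\to\infty} d_{TV}\bigl(X(M_{n,k}^{\alpha}),X(M_{n,k}^{\infty})\bigr)=\tfrac12\,\mathbb{E}\bigl|1-\exp(-\mathcal{N})\bigr|,$$ where $\mathcal{N}$ is a Gaussian random variable with $\mathbb{E}[\mathcal{N}]=\frac{k^2}{4\beta^2}$ and $\mathrm{Var}[\mathcal{N}]=\frac{k^2}{2\beta^2}$, and $d_{TV}$ denotes the total variation distance between the laws of the two integer-valued random variables.
   Context: A $k$-out map on $[n]$ is a map $M:[n]\to[n]^k$, viewed as a digraph on $[n]$ in which each vertex has $k$ out-arcs labeled $1,\dots,k$. The in-degree $D_j(M)$ of vertex $j$ is the total number of coordinates, over all vertices $i$ and all $k$ labels, of $M(i)$ equal to $j$. For $\alpha\in(0,\infty)$, the random $k$-out map $M_{n,k}^{\alpha}$ is generated by inserting $kn$ out-arcs, $k$ per vertex: every vertex starts with weight $\alpha$; at each step a vertex whose out-degree is below $k$ picks its next image $j$ with probability proportional to the current weight of $j$, and the weight of $j$ then increases by $1$. Its law is $P(M_{n,k}^{\alpha}=M)=\prod_{j=1}^n \alpha^{\overline{d_j}}/(\alpha n)^{\overline{kn}}$, where $(d_1,\dots,d_n)$ is the in-degree sequence of $M$ and $x^{\overline{y}}=x(x+1)\cdots(x+y-1)$.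 $M_{n,k}^{\infty}$ denotes the uniformly random $k$-out map on $[n]$ (probability $n^{-kn}$ each). *)

theory Defs
  imports "HOL-Probability.Probability"
begin

text \<open>Vertices are 0..n-1 (standing for [n]); labels are 0..k-1.
  A k-out map is an extensional function M with M i l the l-th image of i.\<close>

definition kout_maps :: "nat \<Rightarrow> nat \<Rightarrow> (nat \<Rightarrow> nat \<Rightarrow> nat) set" where
  "kout_maps n k = Pi\<^sub>E {..<n} (\<lambda>_. Pi\<^sub>E {..<k} (\<lambda>_. {..<n}))"

definition indeg :: "nat \<Rightarrow> nat \<Rightarrow> (nat \<Rightarrow> nat \<Rightarrow> nat) \<Rightarrow> nat \<Rightarrow> nat" where
  "indeg n k M j = card {(i, l). i < n \<and> l < k \<and> M i l = j}"

definition Xstat :: "nat \<Rightarrow> nat \<Rightarrow> (nat \<Rightarrow> nat \<Rightarrow> nat) \<Rightarrow> nat" where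
  "Xstat n k M = (\<Sum>j<n. (indeg n k M j)^2)"

definition prob_alpha :: "nat \<Rightarrow> nat \<Rightarrow> real \<Rightarrow> (nat \<Rightarrow> nat \<Rightarrow> nat) \<Rightarrow> real" where
  "prob_alpha n k \<alpha> M =
     (\<Prod>j<n. pochhammer \<alpha> (indeg n k M j)) / pochhammer (\<alpha> * real n) (k * n)"

definition prob_unif :: "nat \<Rightarrow> nat \<Rightarrow> (nat \<Rightarrow> nat \<Rightarrow> nat) \<Rightarrow> real" where
  "prob_unif n k M = 1 / real n ^ (k * n)"

definition PX_alpha :: "nat \<Rightarrow> nat \<Rightarrow> real \<Rightarrow> nat \<Rightarrow> real" where
  "PX_alpha n k \<alpha> x = (\<Sum>M\<in>{M \<in> kout_maps n k. Xstat n k M = x}. prob_alpha n k \<alpha> M)"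

definition PX_unif :: "nat \<Rightarrow> nat \<Rightarrow> nat \<Rightarrow> real" where
  "PX_unif n k x = (\<Sum>M\<in>{M \<in> kout_maps n k. Xstat n k M = x}. prob_unif n k M)"

text \<open>Total variation distance between the laws of X(M^alpha_{n,k}) and X(M^infty_{n,k});
  both laws are supported on the finite set of values of X on k-out maps.\<close>
definition dTV_X :: "nat \<Rightarrow> nat \<Rightarrow> real \<Rightarrow> real" where
  "dTV_X n k \<alpha> = (1/2) * (\<Sum>x \<in> Xstat n k ` kout_maps n k. \<bar>PX_alpha n k \<alpha> x - PX_unif n k x\<bar>)"

end

theory Submission
  imports Defs "HOL-Real_Asymp.Real_Asymp"
begin

text \<open>
  Write \<open>S = \<Sum>\<^sub>j d\<^sub>j(d\<^sub>j-1)/2\<close>, an affine function of \<open>X\<close>, and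
  \<open>Q = \<Sum>\<^sub>j (0\<^sup>2 + 1\<^sup>2 + ... + (d\<^sub>j-1)\<^sup>2)\<close>; let \<open>m = kn\<close>. Throwing the balls one at a time gives, for every complex \<open>y\<close>,
  \<open>E \<Prod>\<^sub>j (1 + y)(1 + 2y)...(1 + (d\<^sub>j-1)y) = \<Prod>\<^sub>s (1 + ys/n)\<close> (\<open>s < m\<close>) under the uniform law. For \<open>y = i\<theta>/sqrt(n)\<close> the
  product on the left is approximately \<open>exp(i\<theta>S/sqrt(n) + \<theta>\<^sup>2Q/(2n))\<close>, and \<open>Q/n\<close> concentrates, so the identity
  yields the characteristic function of \<open>S\<close> in the limit and hence a central limit theorem for \<open>X\<close>.

  With \<open>\<theta> = 1/\<beta>\<close> and \<open>y = \<theta>/sqrt(n)\<close> the same product is, up to normalisation, the likelihood ratio of the two laws;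
  by concentration of \<open>Q/n\<close> it is at least \<open>exp(-o(1))\<close> times a function \<open>g\<close> of \<open>X\<close> converging in law to
  \<open>exp(-N)\<close>. As the ratio and \<open>exp(-N)\<close> both have mean one, the total variation distance is squeezed
  between \<open>E (min(g,K) - 1)\<^sup>+\<close> and \<open>E (1 - g)\<^sup>+\<close>, up to vanishing errors, for every constant \<open>K\<close>.
\<close>

section \<open>Averages over balls thrown into bins, and their relation to k-out maps\<close>

text \<open>Average over all ways of throwing \<open>t\<close> balls into \<open>n\<close> bins, as an operator on functions of the load vector.\<close>
primrec deg_avg :: "nat \<Rightarrow> nat \<Rightarrow> ((nat \<Rightarrow> nat) \<Rightarrow> 'b::real_vector) \<Rightarrow> 'b" where
  "deg_avg n 0 f = f (\<lambda>_. 0)"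
| "deg_avg n (Suc t) f = deg_avg n t (\<lambda>d. (1 / real n) *\<^sub>R (\<Sum>j<n. f (d(j := Suc (d j)))))"

lemma sum_fun_upd_lessThan:
  fixes F :: "nat \<Rightarrow> 'a \<Rightarrow> 'b::ab_group_add"
  assumes "i < n"
  shows "(\<Sum>j<n. F j ((d(i := x)) j)) = (\<Sum>j<n. F j (d j)) + (F i x - F i (d i))"
proof -
  have "(\<Sum>j<n. F j ((d(i := x)) j)) = F i x + (\<Sum>j\<in>{..<n}-{i}. F j ((d(i := x)) j))"
    using assms by (subst sum.remove[of _ i]) auto
  also have "(\<Sum>j\<in>{..<n}-{i}. F j ((d(i := x)) j)) = (\<Sum>j\<in>{..<n}-{i}. F j (d j))"
    by (intro sum.cong) auto
  finally show ?thesis using assms by (simp add: sum.remove[of "{..<n}" i "\<lambda>j. F j (d j)"])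
qed

text \<open>Only load vectors with total \<open>t\<close> are ever evaluated, so identities under
  the average may use \<open>t\<close> for the number of balls present.\<close>

lemma deg_avg_cong:
  assumes "\<And>d. (\<Sum>j<n. d j) = t \<Longrightarrow> f d = g d"
  shows "deg_avg n t f = deg_avg n t g"
  using assms
proof (induction t arbitrary: f g)
  case (Suc t)
  show ?case unfolding deg_avg.simps
    by (rule Suc.IH, rule arg_cong[where f="scaleR _"], rule sum.cong[OF refl], rule Suc.prems)
       (simp add: sum.remove[of "{..<n}"])
qed simp

lemma deg_avg_add: "deg_avg n t (\<lambda>d. f d + g d) = deg_avg n t f + deg_avg n t g"
  by (induction t arbitrary: f g) (simp_all add: sum.distrib scaleR_add_right)

lemma deg_avg_scaleR: "deg_avg n t (\<lambda>d. c *\<^sub>R f d) = c *\<^sub>R deg_avg n t f"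
  by (induction t arbitrary: f)
     (simp_all add: scaleR_sum_right[symmetric] scaleR_left_commute[of _ c] del: scaleR_scaleR)

lemma deg_avg_diff: "deg_avg n t (\<lambda>d. f d - g d) = deg_avg n t f - deg_avg n t g"
  using deg_avg_add[of n t f "\<lambda>d. (-1) *\<^sub>R g d"] deg_avg_scaleR[of n t "-1" g] by simp

lemma deg_avg_mult_left: "deg_avg n t (\<lambda>d. c * f d) = c * deg_avg n t f"
  for c :: "'a::real_normed_field"
  by (induction t arbitrary: f) (simp_all add: sum_distrib_left[symmetric] mult_scaleR_right[symmetric] del: mult_scaleR_right)

lemma deg_avg_mult_right: "deg_avg n t (\<lambda>d. f d * c) = deg_avg n t f * c"
  for c :: "'a::real_normed_field"
  using deg_avg_mult_left[of n t c f] by (simp add: mult.commute)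

text \<open>With no bins every average after the first throw is 0, as \<open>1 / real 0 = 0\<close>;
  hence the condition on \<open>n\<close> here and below.\<close>

lemma deg_avg_const: "n > 0 \<Longrightarrow> deg_avg n t (\<lambda>_. c) = c"
  by (induction t) (simp_all add: sum_constant_scaleR)

lemma deg_avg_sum:
  "finite A \<Longrightarrow> deg_avg n t (\<lambda>d. \<Sum>x\<in>A. f x d) = (\<Sum>x\<in>A. deg_avg n t (f x))"
proof (induction A rule: finite_induct)
  case empty
  \<comment> \<open>The zero function is written as 0 times some function, so that homogeneity
    applies.\<close>
  have "deg_avg n t (\<lambda>d. 0 *\<^sub>R f undefined d) = 0" by (subst deg_avg_scaleR) simp
  then show ?case by simp
qed (simp add: deg_avg_add)

lemma deg_avg_mono:
  fixes f g :: "(nat \<Rightarrow> nat) \<Rightarrow> real"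
  assumes "\<And>d. (\<Sum>j<n. d j) = t \<Longrightarrow> f d \<le> g d"
  shows "deg_avg n t f \<le> deg_avg n t g"
  using assms
proof (induction t arbitrary: f g)
  case (Suc t)
  show ?case unfolding deg_avg.simps real_scaleR_def
    by (rule Suc.IH, rule mult_left_mono, rule sum_mono, rule Suc.prems)
       (simp_all add: sum.remove[of "{..<n}"])
qed simp

lemma deg_avg_nonneg:
  fixes f :: "(nat \<Rightarrow> nat) \<Rightarrow> real"
  assumes "\<And>d. f d \<ge> 0"
  shows "deg_avg n t f \<ge> 0"
proof -
  have "deg_avg n t (\<lambda>d. 0 * f d) = 0" by (subst deg_avg_mult_left) simp
  then show ?thesis using deg_avg_mono[of n t "\<lambda>_. 0" f] assms by simp
qed

lemma norm_deg_avg_le: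
  fixes f :: "(nat \<Rightarrow> nat) \<Rightarrow> 'a::real_normed_vector"
  shows "norm (deg_avg n t f) \<le> deg_avg n t (\<lambda>d. norm (f d))"
proof (induction t arbitrary: f)
  case (Suc t)
  have "norm (deg_avg n (Suc t) f)
      \<le> deg_avg n t (\<lambda>d. norm ((1 / real n) *\<^sub>R (\<Sum>j<n. f (d(j := Suc (d j))))))"
    by (simp del: norm_scaleR add: Suc.IH)
  also have "\<dots> \<le> deg_avg n (Suc t) (\<lambda>d. norm (f d))"
    by (simp, intro deg_avg_mono mult_left_mono divide_right_mono norm_sum) auto
  finally show ?case .
qed simp

text \<open>The variance of \<open>\<bar>f d\<bar>\<close> under the average is nonnegative, which
  bounds the squared mean by the second moment.\<close>

lemma deg_avg_abs_le_sqrt: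
  assumes "n > 0"
  shows "deg_avg n t (\<lambda>d. \<bar>f d\<bar>) \<le> sqrt (deg_avg n t (\<lambda>d. (f d)\<^sup>2))"
proof -
  define m where "m = deg_avg n t (\<lambda>d. \<bar>f d\<bar>)"
  have "0 \<le> deg_avg n t (\<lambda>d. (\<bar>f d\<bar> - m)\<^sup>2)" by (intro deg_avg_nonneg) simp
  also have "(\<lambda>d. (\<bar>f d\<bar> - m)\<^sup>2) = (\<lambda>d. ((f d)\<^sup>2 - (2*m) * \<bar>f d\<bar>) + m\<^sup>2)"
    by (simp add: power2_diff algebra_simps)
  also have "deg_avg n t \<dots> = deg_avg n t (\<lambda>d. (f d)\<^sup>2) - (2*m)*m + m\<^sup>2"
    by (simp only: deg_avg_add deg_avg_diff deg_avg_mult_left deg_avg_const[OF assms] m_def)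
  finally have "m\<^sup>2 \<le> deg_avg n t (\<lambda>d. (f d)\<^sup>2)" by (simp add: power2_eq_square)
  then show ?thesis unfolding m_def by (rule real_le_rsqrt)
qed

text \<open>An assignment on \<open>insert x I\<close> is one on \<open>I\<close> together with the
  bin \<open>y\<close> of the extra ball, whose load grows by one. This is the recursion of
  \<open>deg_avg\<close>; the power of \<open>n\<close> counts assignments.\<close>

lemma sum_PiE_deg_avg:
  fixes f :: "(nat \<Rightarrow> nat) \<Rightarrow> 'b::real_vector"
  assumes "finite I" "n > 0"
  shows "(\<Sum>h\<in>PiE I (\<lambda>_. {..<n}). f (\<lambda>j. card {i\<in>I. h i = j})) = real n ^ card I *\<^sub>R deg_avg n (card I) f"
  using assms(1)
proof (induction I arbitrary: f rule: finite_induct)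
  case (insert x I)
  define T :: "'a \<Rightarrow> nat set" where "T = (\<lambda>_. {..<n})"
  have inj: "inj_on (\<lambda>(y, g). g(x := y)) (T x \<times> PiE I T)"
    using insert.hyps by (intro inj_combinator)
  have *: "(\<lambda>j. card {i\<in>insert x I. (g(x := y)) i = j})
      = (\<lambda>j. card {i\<in>I. g i = j})(y := Suc (card {i\<in>I. g i = y}))" for g :: "'a \<Rightarrow> nat" and y
  proof
    fix j
    have "{i\<in>insert x I. (g(x := y)) i = j} =
        (if j = y then insert x {i\<in>I. g i = j} else {i\<in>I. g i = j})"
      using insert.hyps by auto
    then show "card {i\<in>insert x I. (g(x := y)) i = j}
        = ((\<lambda>j. card {i\<in>I. g i = j})(y := Suc (card {i\<in>I. g i = y}))) j"
      using insert.hyps by simp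
  qed
  have "(\<Sum>h\<in>PiE (insert x I) T. f (\<lambda>j. card {i\<in>insert x I. h i = j}))
      = (\<Sum>(y,g)\<in>T x \<times> PiE I T. f (\<lambda>j. card {i\<in>insert x I. (g(x := y)) i = j}))"
    unfolding PiE_insert_eq by (subst sum.reindex[OF inj]) (simp add: case_prod_unfold)
  also have "\<dots> = (\<Sum>g\<in>PiE I T. \<Sum>y<n. f ((\<lambda>j. card {i\<in>I. g i = j})(y := Suc (card {i\<in>I. g i = y}))))"
    unfolding * sum.cartesian_product[symmetric] by (subst sum.swap) (simp add: T_def)
  also have "\<dots> = real n ^ card I *\<^sub>R deg_avg n (card I) (\<lambda>d. \<Sum>y<n. f (d(y := Suc (d y))))"
    unfolding T_def by (rule insert.IH[of "\<lambda>d. \<Sum>y<n. f (d(y := Suc (d y)))"])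
  also have "\<dots> = real n ^ card (insert x I) *\<^sub>R deg_avg n (card (insert x I)) f"
    using insert.hyps assms(2) by (simp add: deg_avg_scaleR)
  finally show ?case unfolding T_def .
qed simp

text \<open>The \<open>k * n\<close> labelled arcs are the balls and their endpoints the bins: the
  in-degrees of a uniform k-out map are the loads.\<close>

lemma sum_kout_maps:
  fixes f :: "(nat \<Rightarrow> nat) \<Rightarrow> 'b::real_vector"
  assumes "n > 0"
  shows "(\<Sum>M\<in>kout_maps n k. f (indeg n k M)) = real n ^ (k * n) *\<^sub>R deg_avg n (k * n) f"
proof -
  define I where "I = {..<n} \<times> {..<k}"
  have card: "finite I" "card I = k * n" by (simp_all add: I_def mult.commute)
  \<comment> \<open>Currying and uncurrying; the restrictions keep both results extensional, so the
    two are mutually inverse on the function sets.\<close>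
  define C where "C = (\<lambda>h :: nat \<times> nat \<Rightarrow> nat. \<lambda>i\<in>{..<n}. \<lambda>l\<in>{..<k}. h (i, l))"
  define U where "U = (\<lambda>M :: nat \<Rightarrow> nat \<Rightarrow> nat. \<lambda>(i, l)\<in>I. M i l)"
  have deg: "indeg n k (C h) = (\<lambda>j. card {i\<in>I. h i = j})" for h
    unfolding indeg_def by (intro ext arg_cong[where f=card]) (auto simp: C_def I_def)
  have "(\<Sum>M\<in>kout_maps n k. f (indeg n k M)) = (\<Sum>h\<in>PiE I (\<lambda>_. {..<n}). f (indeg n k (C h)))"
  proof (rule sum.reindex_bij_witness[of _ C U])
    fix M assume M: "M \<in> kout_maps n k"
    show "C (U M) = M"
    proof (intro ext)
      fix i l show "C (U M) i l = M i l"
        using M unfolding kout_maps_def C_def U_def I_def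
        by (cases "i < n"; cases "l < k") (auto simp: PiE_iff extensional_def Pi_iff)
    qed
    then show "f (indeg n k (C (U M))) = f (indeg n k M)" by simp
    show "U M \<in> PiE I (\<lambda>_. {..<n})"
      using M unfolding kout_maps_def U_def I_def by (auto simp: PiE_iff)
  next
    fix h assume h: "h \<in> PiE I (\<lambda>_. {..<n})"
    then show "U (C h) = h"
      unfolding C_def U_def I_def by (auto simp: PiE_iff extensional_def fun_eq_iff)
    show "C h \<in> kout_maps n k"
      using h unfolding kout_maps_def C_def I_def by (auto simp: PiE_iff)
  qed
  then show ?thesis using sum_PiE_deg_avg[OF card(1) assms, of f] by (simp add: deg card)
qed

section \<open>Power sums of the loads (\<open>lowsum 1\<close> counts colliding pairs) and the
  associated products\<close>

definition lowsum :: "nat \<Rightarrow> nat \<Rightarrow> (nat \<Rightarrow> nat) \<Rightarrow> real" where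
  "lowsum p n d = (\<Sum>j<n. \<Sum>a<d j. real a ^ p)"

lemma lowsum_upd: "j < n \<Longrightarrow> lowsum p n (d(j := Suc (d j))) = lowsum p n d + real (d j) ^ p"
  unfolding lowsum_def by (subst sum_fun_upd_lessThan[where F="\<lambda>_ b. \<Sum>a<b. real a ^ p"]) auto

lemma lowsum_nonneg: "lowsum p n d \<ge> 0"
  unfolding lowsum_def by (intro sum_nonneg) auto

text \<open>For \<open>y = 1 / \<alpha>\<close> the inner product is
  \<open>pochhammer \<alpha> (d j) / \<alpha> ^ d j\<close>. For imaginary \<open>y\<close> of order
  \<open>1 / sqrt n\<close> the product is to first order the exponential whose average is a
  characteristic function of \<open>lowsum 1\<close>.\<close>

definition lowprod :: "'a::real_normed_field \<Rightarrow> nat \<Rightarrow> (nat \<Rightarrow> nat) \<Rightarrow> 'a" where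
  "lowprod y n d = (\<Prod>j<n. \<Prod>a<d j. (1 + y * of_nat a))"

lemma lowprod_upd:
  assumes "j < n"
  shows "lowprod y n (d(j := Suc (d j))) = lowprod y n d * (1 + y * of_nat (d j))"
proof -
  have "lowprod y n (d(j := Suc (d j)))
      = (\<Prod>a<Suc (d j). (1 + y * of_nat a)) * (\<Prod>i\<in>{..<n}-{j}. \<Prod>a<(d(j := Suc (d j))) i. (1 + y * of_nat a))"
    unfolding lowprod_def using assms by (subst prod.remove[of _ j]) auto
  also have "(\<Prod>i\<in>{..<n}-{j}. \<Prod>a<(d(j := Suc (d j))) i. (1 + y * of_nat a))
      = (\<Prod>i\<in>{..<n}-{j}. \<Prod>a<d i. (1 + y * of_nat a))"
    by (intro prod.cong) auto
  finally show ?thesis unfolding lowprod_def using assms by (subst (2) prod.remove[of _ j]) auto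
qed

text \<open>A throw into bin \<open>j\<close> contributes the factor \<open>1 + y * d j\<close>; the
  mean of this factor over \<open>j\<close> depends on the loads only through their total. Hence the
  exact product formula that follows.\<close>

lemma lowprod_avg_step:
  fixes y :: "'a::real_normed_field"
  assumes "n > 0" "(\<Sum>j<n. d j) = t"
  shows "(1 / real n) *\<^sub>R (\<Sum>j<n. lowprod y n (d(j := Suc (d j)))) = lowprod y n d * (1 + y * of_nat t / of_nat n)"
proof -
  have "(\<Sum>j<n. lowprod y n (d(j := Suc (d j)))) = (\<Sum>j<n. lowprod y n d * (1 + y * of_nat (d j)))"
    by (intro sum.cong) (simp_all add: lowprod_upd)
  also have "\<dots> = lowprod y n d * (of_nat n + y * of_nat (\<Sum>j<n. d j))"
    by (simp add: sum_distrib_left[symmetric] sum.distrib)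
  finally show ?thesis using assms by (simp add: scaleR_conv_of_real field_simps)
qed

lemma deg_avg_lowprod:
  fixes y :: "'a::real_normed_field"
  assumes "n > 0"
  shows "deg_avg n t (lowprod y n) = (\<Prod>s<t. (1 + y * of_nat s / of_nat n))"
proof (induction t)
  case (Suc t)
  have "deg_avg n (Suc t) (lowprod y n) = deg_avg n t (\<lambda>d. lowprod y n d * (1 + y * of_nat t / of_nat n))"
    unfolding deg_avg.simps by (rule deg_avg_cong) (rule lowprod_avg_step[OF assms])
  then show ?case by (simp add: deg_avg_mult_right Suc)
qed (simp add: lowprod_def)

section \<open>Moments of the degree sequence\<close>

lemma sum_upd_coord:
  fixes F :: "nat \<Rightarrow> real"
  assumes "i < n"
  shows "(\<Sum>l<n. F ((d(l := Suc (d l))) i)) = real n * F (d i) + (F (Suc (d i)) - F (d i))"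
proof -
  have "(\<Sum>l<n. F ((d(l := Suc (d l))) i) - F (d i)) = (\<Sum>l\<in>{i}. F ((d(l := Suc (d l))) i) - F (d i))"
    using assms by (intro sum.mono_neutral_right) auto
  then show ?thesis by (simp add: sum_subtractf)
qed

lemma sum_upd_two_coords:
  fixes F G :: "nat \<Rightarrow> real"
  assumes "i < n" "j < n" "i \<noteq> j"
  shows "(\<Sum>l<n. F ((d(l := Suc (d l))) i) * G ((d(l := Suc (d l))) j))
    = real n * (F (d i) * G (d j)) + (F (Suc (d i)) - F (d i)) * G (d j) + F (d i) * (G (Suc (d j)) - G (d j))"
proof -
  have "(\<Sum>l<n. F ((d(l := Suc (d l))) i) * G ((d(l := Suc (d l))) j) - F (d i) * G (d j))
      = (\<Sum>l\<in>{i,j}. F ((d(l := Suc (d l))) i) * G ((d(l := Suc (d l))) j) - F (d i) * G (d j))"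
    using assms by (intro sum.mono_neutral_right) auto
  then show ?thesis using assms(3) by (simp add: sum_subtractf algebra_simps)
qed

text \<open>A throw doubles \<open>2 ^ d i\<close> with probability \<open>1 / n\<close>. This
  exponential moment dominates the polynomial moments estimated later.\<close>

lemma deg_avg_power_deg:
  assumes "i < n"
  shows "deg_avg n t (\<lambda>d. 2 ^ d i) = (1 + 1 / real n) ^ t"
proof (induction t)
  case (Suc t)
  have "deg_avg n (Suc t) (\<lambda>d. 2 ^ d i) = deg_avg n t (\<lambda>d. 2 ^ d i * (1 + 1 / real n))"
    unfolding deg_avg.simps using assms
    by (intro deg_avg_cong, subst sum_upd_coord[where F="\<lambda>x. 2 ^ x"]) (auto simp: field_simps)
  then show ?case by (simp only: deg_avg_mult_right Suc power_Suc2)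
qed simp

lemma choose_Suc_diff: "real (Suc b choose r) - real (b choose r) = (if r = 0 then 0 else real (b choose (r - 1)))"
  by (cases r) auto

text \<open>By Pascal's rule, a ball landing in bin \<open>i\<close> adds
  \<open>d i choose (r - 1)\<close>, so the average obeys the recursion of
  \<open>t choose r\<close>.\<close>

lemma deg_avg_choose:
  assumes "i < n"
  shows "deg_avg n t (\<lambda>d. real (d i choose r)) = real (t choose r) / real n ^ r"
proof (induction t arbitrary: r)
  case 0
  then show ?case by (cases r) auto
next
  case (Suc t)
  have "deg_avg n (Suc t) (\<lambda>d. real (d i choose r))
      = deg_avg n t (\<lambda>d. real (d i choose r) + (1 / real n) * (if r = 0 then 0 else real (d i choose (r - 1))))"
    unfolding deg_avg.simps using assms
    by (intro deg_avg_cong, subst sum_upd_coord[where F="\<lambda>x. real (x choose r)"])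
       (auto simp: field_simps choose_Suc_diff)
  also have "\<dots> = real (t choose r) / real n ^ r
      + (1 / real n) * deg_avg n t (\<lambda>d. if r = 0 then 0 else real (d i choose (r - 1)))"
    by (simp only: deg_avg_add deg_avg_mult_left Suc)
  also have "\<dots> = real (Suc t choose r) / real n ^ r"
    using assms by (cases r) (auto simp: Suc deg_avg_const field_simps)
  finally show ?case .
qed

text \<open>Negative correlation of distinct bins. A ball lands in at most one of them, whereas
  passing from \<open>t\<close> to \<open>Suc t\<close> on the right also produces a nonnegative
  product of both increments; dropping it gives the induction step.\<close>

lemma deg_avg_choose_mult_le:
  assumes "i < n" "j < n" "i \<noteq> j"
  shows "deg_avg n t (\<lambda>d. real (d i choose r) * real (d j choose s))
    \<le> (real (t choose r) / real n ^ r) * (real (t choose s) / real n ^ s)"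
proof (induction t arbitrary: r s)
  case 0
  then show ?case by (cases r; cases s) auto
next
  case (Suc t)
  let ?E = "\<lambda>r s. deg_avg n t (\<lambda>d. real (d i choose r) * real (d j choose s))"
  let ?u = "\<lambda>r. real (t choose r) / real n ^ r"
  let ?dr = "\<lambda>b. if r = 0 then 0 else real (b choose (r - 1))"
  let ?ds = "\<lambda>b. if s = 0 then 0 else real (b choose (s - 1))"
  have n: "n > 0" using assms by simp
  have "deg_avg n (Suc t) (\<lambda>d. real (d i choose r) * real (d j choose s))
      = deg_avg n t (\<lambda>d. real (d i choose r) * real (d j choose s)
          + (1 / real n) * (?dr (d i) * real (d j choose s))
          + (1 / real n) * (real (d i choose r) * ?ds (d j)))"
    unfolding deg_avg.simps
    by (intro deg_avg_cong, subst sum_upd_two_coords[OF assms, where F="\<lambda>x. real (x choose r)" and G="\<lambda>x. real (x choose s)"])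
       (use n in \<open>simp add: field_simps choose_Suc_diff\<close>)
  also have "\<dots> = ?E r s + (1 / real n) * deg_avg n t (\<lambda>d. ?dr (d i) * real (d j choose s))
      + (1 / real n) * deg_avg n t (\<lambda>d. real (d i choose r) * ?ds (d j))"
    by (simp only: deg_avg_add deg_avg_mult_left)
  also have "\<dots> \<le> ?u r * ?u s + (1 / real n) * (if r = 0 then 0 else ?u (r - 1) * ?u s)
      + (1 / real n) * (if s = 0 then 0 else ?u r * ?u (s - 1))"
    using n Suc[of r s] Suc[of "r - 1" s] Suc[of r "s - 1"]
    by (intro add_mono mult_left_mono) (auto simp: deg_avg_const)
  also have "\<dots> \<le> (real (Suc t choose r) / real n ^ r) * (real (Suc t choose s) / real n ^ s)"
    using n by (cases r; cases s) (auto simp: field_simps)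
  finally show ?case .
qed

lemma real_choose_2: "real (m choose 2) = real m * (real m - 1) / 2"
  by (induction m) (auto simp: numeral_2_eq_2 field_simps)

lemma real_choose_3: "real (m choose 3) = real m * (real m - 1) * (real m - 2) / 6"
proof (induction m)
  case (Suc m)
  have "Suc m choose 3 = (m choose 2) + (m choose 3)" by (simp add: numeral_3_eq_3 numeral_2_eq_2)
  then show ?case using Suc by (simp add: real_choose_2 field_simps)
qed simp

text \<open>In the binomial basis the averages are given exactly by
  \<open>deg_avg_choose\<close>.\<close>

lemma sum_squares_choose: "(\<Sum>a<b. real a ^ 2) = 2 * real (b choose 3) + real (b choose 2)"
  by (induction b) (auto simp: real_choose_3 real_choose_2 power2_eq_square field_simps)

lemma deg_avg_lowsum_2:
  assumes "n > 0"
  shows "deg_avg n t (lowsum 2 n) = real n * (2 * (real (t choose 3) / real n ^ 3) + real (t choose 2) / real n ^ 2)"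
proof -
  have "deg_avg n t (lowsum 2 n) = (\<Sum>j<n. deg_avg n t (\<lambda>d. 2 * real (d j choose 3) + real (d j choose 2)))"
    unfolding lowsum_def sum_squares_choose by (rule deg_avg_sum) simp
  also have "\<dots> = (\<Sum>j<n. 2 * (real (t choose 3) / real n ^ 3) + real (t choose 2) / real n ^ 2)"
    by (intro sum.cong refl) (simp only: deg_avg_add deg_avg_mult_left deg_avg_choose lessThan_iff)
  finally show ?thesis by simp
qed

text \<open>The exponent 6 is twice the degree 3 of a bin's contribution to \<open>lowsum 2\<close>,
  whose square is to be averaged; the base 2 fits \<open>deg_avg_power_deg\<close>.\<close>

lemma obtain_power6_bound:
  obtains C :: real where "C \<ge> 0" "\<And>b. real b ^ 6 \<le> C * 2 ^ b"
proof -
  have "(\<lambda>b. real b ^ 6 / 2 ^ b) \<longlonglongrightarrow> 0" by real_asymp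
  then have "Bseq (\<lambda>b. real b ^ 6 / 2 ^ b)" by (rule convergent_imp_Bseq[OF convergentI])
  then obtain C where C: "C > 0" "\<And>b. norm (real b ^ 6 / 2 ^ b) \<le> C" by (auto simp: Bseq_def)
  show thesis by (rule that[of C]) (use C in \<open>auto simp: field_simps\<close>)
qed

lemma sum_powers_le: "(\<Sum>a<b. real a ^ p) \<le> real b ^ Suc p"
proof -
  have "(\<Sum>a<b. real a ^ p) \<le> (\<Sum>a<b. real b ^ p)" by (intro sum_mono power_mono) auto
  then show ?thesis by simp
qed

lemma power_one_plus_inverse_le: 
  assumes "n > 0"
  shows "(1 + 1 / real n) ^ (k * n) \<le> exp (real k)"
proof -
  have "(1 + 1 / real n) ^ (k * n) \<le> exp (1 / real n) ^ (k * n)"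
    by (intro power_mono) (simp_all add: exp_ge_add_one_self)
  also have "\<dots> = exp (real k)" using assms by (simp add: exp_of_nat_mult[symmetric])
  finally show ?thesis .
qed

text \<open>The contributions of the bins are nonnegative combinations of binomial coefficients, so
  those of distinct bins have nonpositive covariance. Only the \<open>n\<close> diagonal terms
  remain, each at most a constant.\<close>

lemma deg_avg_lowsum_2_variance:
  fixes n k :: nat
  assumes C: "\<And>b. real b ^ 6 \<le> C * 2 ^ b" "C \<ge> 0" and n: "n > 0"
  defines "\<mu> \<equiv> deg_avg n (k * n) (lowsum 2 n)"
  shows "deg_avg n (k * n) (\<lambda>d. (lowsum 2 n d - \<mu>)\<^sup>2) \<le> real n * (C * exp (real k))"
proof -
  let ?t = "k * n"
  define q where "q = (\<lambda>b. 2 * real (b choose 3) + real (b choose 2))"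
  define u where "u = 2 * (real (?t choose 3) / real n ^ 3) + real (?t choose 2) / real n ^ 2"
  have \<mu>: "\<mu> = real n * u" unfolding \<mu>_def u_def by (rule deg_avg_lowsum_2[OF n])
  have Q: "lowsum 2 n d = (\<Sum>j<n. q (d j))" for d unfolding lowsum_def sum_squares_choose q_def ..
  have off: "deg_avg n ?t (\<lambda>d. q (d i) * q (d j)) \<le> u * u" if "i < n" "j < n" "i \<noteq> j" for i j
  proof -
    have "(\<lambda>d. q (d i) * q (d j)) = (\<lambda>d. 4 * (real (d i choose 3) * real (d j choose 3))
        + 2 * (real (d i choose 3) * real (d j choose 2)) + 2 * (real (d i choose 2) * real (d j choose 3))
        + real (d i choose 2) * real (d j choose 2))"
      unfolding q_def by (simp add: algebra_simps)
    then have "deg_avg n ?t (\<lambda>d. q (d i) * q (d j))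
      = 4 * deg_avg n ?t (\<lambda>d. real (d i choose 3) * real (d j choose 3))
        + 2 * deg_avg n ?t (\<lambda>d. real (d i choose 3) * real (d j choose 2))
        + 2 * deg_avg n ?t (\<lambda>d. real (d i choose 2) * real (d j choose 3))
        + deg_avg n ?t (\<lambda>d. real (d i choose 2) * real (d j choose 2))"
      by (simp only: deg_avg_add deg_avg_mult_left)
    also have "\<dots> \<le> 4 * ((real (?t choose 3) / real n ^ 3) * (real (?t choose 3) / real n ^ 3))
        + 2 * ((real (?t choose 3) / real n ^ 3) * (real (?t choose 2) / real n ^ 2))
        + 2 * ((real (?t choose 2) / real n ^ 2) * (real (?t choose 3) / real n ^ 3))
        + (real (?t choose 2) / real n ^ 2) * (real (?t choose 2) / real n ^ 2)"
      by (intro add_mono mult_left_mono deg_avg_choose_mult_le that) auto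
    also have "\<dots> = u * u" unfolding u_def by (simp only: algebra_simps)
    finally show ?thesis .
  qed
  have diag: "deg_avg n ?t (\<lambda>d. q (d i) * q (d i)) \<le> C * exp (real k)" if "i < n" for i
  proof -
    have "deg_avg n ?t (\<lambda>d. q (d i) * q (d i)) \<le> deg_avg n ?t (\<lambda>d. C * 2 ^ d i)"
    proof (rule deg_avg_mono)
      fix d :: "nat \<Rightarrow> nat"
      have "q (d i) \<le> real (d i) ^ 3"
        unfolding q_def sum_squares_choose[symmetric] using sum_powers_le[of 2] by (simp add: numeral_3_eq_3)
      then have "q (d i) * q (d i) \<le> real (d i) ^ 3 * real (d i) ^ 3"
        by (intro mult_mono) (auto simp: q_def)
      also have "\<dots> \<le> C * 2 ^ d i" using C(1)[of "d i"] by (simp add: power_add[symmetric])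
      finally show "q (d i) * q (d i) \<le> C * 2 ^ d i" .
    qed
    also have "\<dots> = C * (1 + 1 / real n) ^ ?t" by (simp only: deg_avg_mult_left deg_avg_power_deg[OF that])
    also have "\<dots> \<le> C * exp (real k)" by (intro mult_left_mono power_one_plus_inverse_le n C)
    finally show ?thesis .
  qed
  have "deg_avg n ?t (\<lambda>d. (lowsum 2 n d)\<^sup>2) = (\<Sum>i<n. \<Sum>j<n. deg_avg n ?t (\<lambda>d. q (d i) * q (d j)))"
    unfolding Q power2_eq_square sum_product by (simp add: deg_avg_sum)
  also have "\<dots> \<le> (\<Sum>i<n. \<Sum>j<n. u * u + (if i = j then C * exp (real k) else 0))"
  proof (intro sum_mono)
    fix i j assume "i \<in> {..<n}" "j \<in> {..<n}"
    then show "deg_avg n ?t (\<lambda>d. q (d i) * q (d j)) \<le> u * u + (if i = j then C * exp (real k) else 0)"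
      using off[of i j] diag[of i] by (cases "i = j") (auto intro: add_increasing)
  qed
  also have "\<dots> = \<mu>\<^sup>2 + real n * (C * exp (real k))"
    by (simp add: sum.distrib \<mu> power2_eq_square algebra_simps)
  finally have *: "deg_avg n ?t (\<lambda>d. (lowsum 2 n d)\<^sup>2) \<le> \<mu>\<^sup>2 + real n * (C * exp (real k))" .
  have "deg_avg n ?t (\<lambda>d. (lowsum 2 n d - \<mu>)\<^sup>2) = deg_avg n ?t (\<lambda>d. ((lowsum 2 n d)\<^sup>2 - (2 * \<mu>) * lowsum 2 n d) + \<mu>\<^sup>2)"
    by (simp add: power2_diff algebra_simps)
  also have "\<dots> = deg_avg n ?t (\<lambda>d. (lowsum 2 n d)\<^sup>2) - (2 * \<mu>) * \<mu> + \<mu>\<^sup>2"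
    by (simp only: deg_avg_add deg_avg_diff deg_avg_mult_left deg_avg_const[OF n] \<mu>_def)
  finally show ?thesis using * by (simp add: power2_eq_square)
qed

text \<open>The mean of \<open>\<Sum>a<b. real a ^ 2\<close> when \<open>b\<close> is Poisson with
  mean \<open>k\<close>, the limiting law of a load; hence the limit of the mean of
  \<open>lowsum 2 n d / n\<close>.\<close>

definition lowsum2_lim :: "nat \<Rightarrow> real" where
  "lowsum2_lim k = real k ^ 3 / 3 + real k ^ 2 / 2"

text \<open>Fluctuations around the mean \<open>\<mu> n\<close> are at most of order
  \<open>sqrt n\<close> by the variance bound and vanish after division by \<open>n\<close>; the
  rest is the convergence of the mean, which is explicit.\<close>

lemma tendsto_deg_avg_lowsum_2:
  "(\<lambda>n. deg_avg n (k * n) (\<lambda>d. \<bar>lowsum 2 n d / real n - lowsum2_lim k\<bar>)) \<longlonglongrightarrow> 0"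
proof -
  obtain C where C: "C \<ge> 0" "\<And>b. real b ^ 6 \<le> C * 2 ^ b" by (rule obtain_power6_bound) blast
  define \<mu> where "\<mu> = (\<lambda>n. deg_avg n (k * n) (lowsum 2 n))"
  define D where "D = C * exp (real k)"
  define bnd where "bnd = (\<lambda>n. sqrt (D / real n) + \<bar>\<mu> n / real n - lowsum2_lim k\<bar>)"
  have "(\<lambda>n. (2 * ((real k * real n) * (real k * real n - 1) * (real k * real n - 2) / 6 / real n ^ 3)
      + (real k * real n) * (real k * real n - 1) / 2 / real n ^ 2)) \<longlonglongrightarrow> lowsum2_lim k"
    unfolding lowsum2_lim_def by (real_asymp simp: field_simps power2_eq_square power3_eq_cube)
  then have "(\<lambda>n. \<mu> n / real n) \<longlonglongrightarrow> lowsum2_lim k"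
  proof (rule Lim_transform_eventually)
    show "\<forall>\<^sub>F n in sequentially. (2 * ((real k * real n) * (real k * real n - 1) * (real k * real n - 2) / 6 / real n ^ 3)
      + (real k * real n) * (real k * real n - 1) / 2 / real n ^ 2) = \<mu> n / real n"
      using eventually_gt_at_top[of 0]
      by eventually_elim (simp add: \<mu>_def deg_avg_lowsum_2 real_choose_2 real_choose_3)
  qed
  then have "(\<lambda>n. \<bar>\<mu> n / real n - lowsum2_lim k\<bar>) \<longlonglongrightarrow> \<bar>lowsum2_lim k - lowsum2_lim k\<bar>"
    by (intro tendsto_intros)
  moreover have "(\<lambda>n. sqrt (D / real n)) \<longlonglongrightarrow> sqrt 0" by (intro tendsto_intros tendsto_divide_0[OF tendsto_const] filterlim_real_sequentially filterlim_at_top_imp_at_infinity)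
  ultimately have "bnd \<longlonglongrightarrow> 0" unfolding bnd_def using tendsto_add by fastforce
  then show ?thesis
  proof (rule Lim_null_comparison[rotated])
    show "\<forall>\<^sub>F n in sequentially. norm (deg_avg n (k * n) (\<lambda>d. \<bar>lowsum 2 n d / real n - lowsum2_lim k\<bar>)) \<le> bnd n"
      using eventually_gt_at_top[of 0]
    proof eventually_elim
      case (elim n)
      have sq: "deg_avg n (k * n) (\<lambda>d. ((lowsum 2 n d - \<mu> n) / real n)\<^sup>2) \<le> D / real n"
      proof -
        have "deg_avg n (k * n) (\<lambda>d. ((lowsum 2 n d - \<mu> n) / real n)\<^sup>2)
            = (1 / (real n)\<^sup>2) * deg_avg n (k * n) (\<lambda>d. (lowsum 2 n d - \<mu> n)\<^sup>2)"
          by (subst deg_avg_mult_left[symmetric]) (simp add: power_divide)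
        also have "\<dots> \<le> (1 / (real n)\<^sup>2) * (real n * D)"
          unfolding \<mu>_def D_def by (intro mult_left_mono deg_avg_lowsum_2_variance C elim) auto
        also have "\<dots> = D / real n" using elim by (simp add: power2_eq_square field_simps)
        finally show ?thesis .
      qed
      have "deg_avg n (k * n) (\<lambda>d. \<bar>lowsum 2 n d / real n - lowsum2_lim k\<bar>)
          \<le> deg_avg n (k * n) (\<lambda>d. \<bar>(lowsum 2 n d - \<mu> n) / real n\<bar> + \<bar>\<mu> n / real n - lowsum2_lim k\<bar>)"
        by (intro deg_avg_mono) (simp add: diff_divide_distrib)
      also have "\<dots> = deg_avg n (k * n) (\<lambda>d. \<bar>(lowsum 2 n d - \<mu> n) / real n\<bar>) + \<bar>\<mu> n / real n - lowsum2_lim k\<bar>"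
        by (simp only: deg_avg_add deg_avg_const[OF elim])
      also have "\<dots> \<le> bnd n"
        unfolding bnd_def
        by (intro add_mono order_refl order_trans[OF deg_avg_abs_le_sqrt[OF elim]] real_sqrt_le_mono sq)
      finally show ?case by (simp add: abs_of_nonneg deg_avg_nonneg)
    qed
  qed
qed

text \<open>The average of \<open>lowsum 3\<close> is at most of order \<open>n\<close>, while the
  normalisation \<open>n * sqrt n\<close> comes from the cube of a parameter of order
  \<open>1 / sqrt n\<close>.\<close>

lemma tendsto_deg_avg_lowsum_3:
  "(\<lambda>n. deg_avg n (k * n) (\<lambda>d. lowsum 3 n d / (real n * sqrt (real n)))) \<longlonglongrightarrow> 0"
proof -
  obtain C where C: "C \<ge> 0" "\<And>b. real b ^ 6 \<le> C * 2 ^ b" by (rule obtain_power6_bound) blast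
  have "(\<lambda>n. C * exp (real k) / sqrt (real n)) \<longlonglongrightarrow> 0" by real_asymp
  then show ?thesis
  proof (rule Lim_null_comparison[rotated])
    show "\<forall>\<^sub>F n in sequentially. norm (deg_avg n (k * n) (\<lambda>d. lowsum 3 n d / (real n * sqrt (real n))))
        \<le> C * exp (real k) / sqrt (real n)"
      using eventually_gt_at_top[of 0]
    proof eventually_elim
      case (elim n)
      have low: "lowsum 3 n d \<le> (\<Sum>j<n. C * 2 ^ d j)" for d
        unfolding lowsum_def
      proof (rule sum_mono)
        fix j
        have "(\<Sum>a<d j. real a ^ 3) \<le> real (d j) ^ 4" using sum_powers_le[of 3 "d j"] by simp
        \<comment> \<open>The exponent is raised in order to reuse the bound by
          \<open>2 ^ d j\<close>; this is monotone because \<open>d j\<close> is either 0 or at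
          least 1.\<close>
        also have "\<dots> \<le> real (d j) ^ 6"
          by (cases "d j = 0") (auto intro!: power_increasing)
        also have "\<dots> \<le> C * 2 ^ d j" by (rule C)
        finally show "(\<Sum>a<d j. real a ^ 3) \<le> C * 2 ^ d j" .
      qed
      have "deg_avg n (k * n) (\<lambda>d. lowsum 3 n d / (real n * sqrt (real n)))
          \<le> deg_avg n (k * n) (\<lambda>d. (\<Sum>j<n. C * 2 ^ d j) / (real n * sqrt (real n)))"
        by (intro deg_avg_mono divide_right_mono low) auto
      also have "\<dots> = (\<Sum>j<n. C * deg_avg n (k * n) (\<lambda>d. 2 ^ d j)) / (real n * sqrt (real n))"
        by (simp only: divide_inverse deg_avg_mult_right deg_avg_sum[OF finite_lessThan] deg_avg_mult_left)
      also have "\<dots> \<le> (\<Sum>j<n. C * exp (real k)) / (real n * sqrt (real n))"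
        using C elim
        by (intro divide_right_mono sum_mono mult_left_mono) (auto simp: deg_avg_power_deg power_one_plus_inverse_le)
      also have "\<dots> = C * exp (real k) / sqrt (real n)" using elim by simp
      finally show ?case by (simp add: abs_of_nonneg deg_avg_nonneg lowsum_nonneg)
    qed
  qed
qed

section \<open>Characteristic function of the number of colliding pairs\<close>

lemma norm_one_plus_ii_le: "norm (1 + \<i> * complex_of_real x) \<le> exp (x\<^sup>2 / 2)"
proof -
  have "norm (1 + \<i> * complex_of_real x) = sqrt (1 + x\<^sup>2)" by (simp add: cmod_def)
  also have "\<dots> \<le> sqrt (exp (x\<^sup>2))" by (intro real_sqrt_le_mono) (simp add: exp_ge_add_one_self)
  also have "\<dots> = exp (x\<^sup>2 / 2)"
    by (rule real_sqrt_unique) (simp_all add: exp_double[symmetric])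
  finally show ?thesis .
qed

text \<open>The exponent removes the logarithm of the first factor up to second order: in the
  derivative all terms cancel but \<open>- \<i> * z\<^sup>2\<close> times the exponential, whose
  modulus is at most 1 on the real segment.\<close>

lemma norm_one_plus_ii_exp_diff_le:
  "norm ((1 + \<i> * complex_of_real x) * exp (- (\<i> * complex_of_real x) - (complex_of_real x)\<^sup>2 / 2) - 1) \<le> \<bar>x\<bar> ^ 3"
proof -
  define f where "f = (\<lambda>z. (1 + \<i> * z) * exp (- (\<i> * z) - z\<^sup>2 / 2))"
  define f' where "f' = (\<lambda>z. - \<i> * z\<^sup>2 * exp (- (\<i> * z) - z\<^sup>2 / 2))"
  have "norm (f (complex_of_real x) - f 0) \<le> x\<^sup>2 * norm (complex_of_real x - 0)"
  proof (rule field_differentiable_bound[of "closed_segment 0 (complex_of_real x)" f f'])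
    fix z assume z: "z \<in> closed_segment 0 (complex_of_real x)"
    show "(f has_field_derivative f' z) (at z within closed_segment 0 (complex_of_real x))"
      unfolding f_def f'_def
      by (auto intro!: derivative_eq_intros simp: field_simps power2_eq_square)
    from z obtain u where u: "0 \<le> u" "u \<le> 1" "z = complex_of_real (u * x)"
      by (auto simp: in_segment scaleR_conv_of_real)
    have "norm (f' z) = (u * x)\<^sup>2 * exp (- ((u * x)\<^sup>2 / 2))"
      unfolding f'_def u(3) by (simp add: norm_mult norm_power power2_eq_square)
    also have "\<dots> \<le> (u * x)\<^sup>2 * 1" by (intro mult_left_mono) auto
    also have "\<dots> \<le> x\<^sup>2"
      using u by (simp add: power_mult_distrib mult_left_le_one_le power_le_one)
    finally show "norm (f' z) \<le> x\<^sup>2" .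
  qed auto
  then show ?thesis unfolding f_def by (simp add: power3_eq_cube power2_eq_square)
qed

lemma norm_prod_one_plus_ii_le:
  assumes "finite I"
  shows "norm (\<Prod>s\<in>I. 1 + \<i> * complex_of_real (x s)) \<le> exp ((\<Sum>s\<in>I. (x s)\<^sup>2) / 2)"
proof -
  have "norm (\<Prod>s\<in>I. 1 + \<i> * complex_of_real (x s)) \<le> (\<Prod>s\<in>I. exp ((x s)\<^sup>2 / 2))"
    unfolding prod_norm[symmetric] by (intro prod_mono) (simp add: norm_one_plus_ii_le)
  then show ?thesis using assms by (simp add: exp_sum[symmetric] sum_divide_distrib)
qed

text \<open>Every compensated factor \<open>g\<close> has modulus at most 1, so replacing the
  factors by 1 one after another costs at most the sum of their individual errors.\<close>

lemma norm_prod_one_plus_ii_exp_diff_le: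
  assumes "finite I"
  shows "norm ((\<Prod>s\<in>I. 1 + \<i> * complex_of_real (x s))
      * exp (- (\<i> * complex_of_real (\<Sum>s\<in>I. x s)) - complex_of_real ((\<Sum>s\<in>I. (x s)\<^sup>2) / 2)) - 1)
    \<le> (\<Sum>s\<in>I. \<bar>x s\<bar> ^ 3)"
proof -
  define g where "g = (\<lambda>x. (1 + \<i> * complex_of_real x) * exp (- (\<i> * complex_of_real x) - (complex_of_real x)\<^sup>2 / 2))"
  have g: "norm (g x) \<le> 1" for x
  proof -
    have "norm (g x) = norm (1 + \<i> * complex_of_real x) * exp (- (x\<^sup>2 / 2))"
      unfolding g_def by (simp add: norm_mult power2_eq_square)
    also have "\<dots> \<le> exp (x\<^sup>2 / 2) * exp (- (x\<^sup>2 / 2))"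
      by (intro mult_right_mono norm_one_plus_ii_le) auto
    finally show ?thesis by (simp add: exp_minus)
  qed
  have "(\<Prod>s\<in>I. 1 + \<i> * complex_of_real (x s))
      * exp (- (\<i> * complex_of_real (\<Sum>s\<in>I. x s)) - complex_of_real ((\<Sum>s\<in>I. (x s)\<^sup>2) / 2))
      = (\<Prod>s\<in>I. g (x s))"
    unfolding g_def prod.distrib exp_sum[OF assms, symmetric]
    by (simp add: sum_subtractf sum_negf sum_distrib_left sum_divide_distrib)
  then have "norm ((\<Prod>s\<in>I. 1 + \<i> * complex_of_real (x s))
      * exp (- (\<i> * complex_of_real (\<Sum>s\<in>I. x s)) - complex_of_real ((\<Sum>s\<in>I. (x s)\<^sup>2) / 2)) - 1)
      = norm ((\<Prod>s\<in>I. g (x s)) - (\<Prod>s\<in>I. 1))" by simp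
  also have "\<dots> \<le> (\<Sum>s\<in>I. norm (g (x s) - 1))" by (intro norm_prod_diff g) auto
  also have "\<dots> \<le> (\<Sum>s\<in>I. \<bar>x s\<bar> ^ 3)"
    unfolding g_def by (intro sum_mono norm_one_plus_ii_exp_diff_le)
  finally show ?thesis .
qed

lemma lowsum_scaled_Sigma:
  "(\<Sum>(j, a)\<in>Sigma {..<n} (\<lambda>j. {..<d j}). c * real a ^ p) = c * lowsum p n d"
  unfolding lowsum_def by (simp add: sum.Sigma[symmetric] sum_distrib_left)

lemma lowprod_Sigma:
  "lowprod y n d = (\<Prod>(j, a)\<in>Sigma {..<n} (\<lambda>j. {..<d j}). 1 + y * of_nat a)"
  unfolding lowprod_def by (simp add: prod.Sigma)

lemma norm_lowprod_ii_le:
  "norm (lowprod (\<i> * complex_of_real z) n d) \<le> exp (z\<^sup>2 * lowsum 2 n d / 2)"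
proof -
  have "norm (\<Prod>s\<in>Sigma {..<n} (\<lambda>j. {..<d j}). 1 + \<i> * complex_of_real (z * real (snd s)))
      \<le> exp ((\<Sum>s\<in>Sigma {..<n} (\<lambda>j. {..<d j}). (z * real (snd s))\<^sup>2) / 2)"
    by (rule norm_prod_one_plus_ii_le) auto
  then show ?thesis unfolding lowprod_Sigma
    using lowsum_scaled_Sigma[where c="z\<^sup>2" and p=2 and n=n and d=d]
    by (simp add: case_prod_unfold power_mult_distrib algebra_simps)
qed

lemma norm_lowprod_ii_exp_diff_le:
  "norm (lowprod (\<i> * complex_of_real z) n d
      * exp (- (\<i> * complex_of_real (z * lowsum 1 n d)) - complex_of_real (z\<^sup>2 * lowsum 2 n d / 2)) - 1)
    \<le> \<bar>z\<bar> ^ 3 * lowsum 3 n d"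
proof -
  let ?I = "Sigma {..<n} (\<lambda>j. {..<d j})"
  have "norm ((\<Prod>s\<in>?I. 1 + \<i> * complex_of_real (z * real (snd s)))
      * exp (- (\<i> * complex_of_real (\<Sum>s\<in>?I. z * real (snd s))) - complex_of_real ((\<Sum>s\<in>?I. (z * real (snd s))\<^sup>2) / 2)) - 1)
    \<le> (\<Sum>s\<in>?I. \<bar>z * real (snd s)\<bar> ^ 3)"
    by (rule norm_prod_one_plus_ii_exp_diff_le) auto
  moreover have "(\<Sum>s\<in>?I. z * real (snd s)) = z * lowsum 1 n d"
    using lowsum_scaled_Sigma[where c=z and p=1 and n=n and d=d] by (simp add: case_prod_unfold)
  moreover have "(\<Sum>s\<in>?I. (z * real (snd s))\<^sup>2) = z\<^sup>2 * lowsum 2 n d"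
    using lowsum_scaled_Sigma[where c="z\<^sup>2" and p=2 and n=n and d=d]
    by (simp add: case_prod_unfold power_mult_distrib)
  moreover have "(\<Sum>s\<in>?I. \<bar>z * real (snd s)\<bar> ^ 3) = \<bar>z\<bar> ^ 3 * lowsum 3 n d"
    using lowsum_scaled_Sigma[where c="\<bar>z\<bar>^3" and p=3 and n=n and d=d]
    by (simp add: case_prod_unfold power_mult_distrib abs_mult)
  moreover have "(\<Prod>s\<in>?I. 1 + \<i> * complex_of_real (z * real (snd s))) = lowprod (\<i> * complex_of_real z) n d"
    unfolding lowprod_Sigma by (simp add: case_prod_unfold algebra_simps)
  ultimately show ?thesis by (simp only:)
qed

text \<open>If \<open>d j = Suc b\<close>, the term \<open>b ^ 2\<close> already occurs in
  \<open>lowsum 2\<close>, and \<open>(b + 1) ^ 2 \<le> 2 * b ^ 2 + 2\<close>. As a throw into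
  \<open>j\<close> adds \<open>(d j) ^ 2\<close>, this limits the overshoot when a level is first
  exceeded.\<close>

lemma deg_squared_le_lowsum_2:
  assumes "j < n"
  shows "(real (d j))\<^sup>2 \<le> 2 * lowsum 2 n d + 2"
proof (cases "d j")
  case (Suc b)
  have "real b ^ 2 \<le> (\<Sum>a<d j. real a ^ 2)" using Suc by (intro member_le_sum) auto
  also have "\<dots> \<le> lowsum 2 n d"
    unfolding lowsum_def using assms by (intro member_le_sum) (auto intro: sum_nonneg)
  finally have "real b ^ 2 \<le> lowsum 2 n d" .
  moreover have "(real (d j))\<^sup>2 \<le> 2 * real b ^ 2 + 2"
    using Suc zero_le_power2[of "real b - 1"] by (simp add: power2_eq_square algebra_simps)
  ultimately show ?thesis by simp
qed (simp add: lowsum_nonneg)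

text \<open>The average of the product is multiplicative in \<open>t\<close>, the truncation set is left only once,
  and the product is still bounded at that moment.\<close>
lemma norm_deg_avg_lowprod_truncated:
  fixes z B :: real
  assumes "n > 0" "B \<ge> 0"
  defines "w \<equiv> \<lambda>t. \<Prod>s<t. (1 + \<i> * complex_of_real z * of_nat s / of_nat n)"
  shows "norm (deg_avg n t (\<lambda>d. if lowsum 2 n d \<le> B then lowprod (\<i> * complex_of_real z) n d else 0) - w t)
    \<le> exp (z\<^sup>2 * (3 * B + 2) / 2) * norm (w t) * deg_avg n t (\<lambda>d. if lowsum 2 n d \<le> B then 0 else 1)"
proof (induction t)
  case 0
  then show ?case using assms by (simp add: lowsum_def lowprod_def w_def)
next
  case (Suc t)
  define C where "C = exp (z\<^sup>2 * (3 * B + 2) / 2)"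
  define W where "W = lowprod (\<i> * complex_of_real z) n"
  define F where "F = (\<lambda>d. if lowsum 2 n d \<le> B then W d else 0)"
  define P where "P = (\<lambda>d. if lowsum 2 n d \<le> B then 0 else 1 :: real)"
  define \<rho> where "\<rho> = 1 + \<i> * complex_of_real z * of_nat t / of_nat n"
  let ?up = "\<lambda>d j. d(j := Suc (d j))"
  have n: "n > 0" by fact
  \<comment> \<open>Up to exit the product follows its exact recursion, so the defect is the product
    lost at exit, charged to the increase of the exit indicator \<open>P\<close>. After exit both
    sides vanish, since \<open>lowsum 2\<close> cannot decrease.\<close>
  have step: "norm ((1 / real n) *\<^sub>R (\<Sum>j<n. F (?up d j)) - F d * \<rho>) \<le> C * ((1 / real n) * (\<Sum>j<n. P (?up d j)) - P d)"
    if d: "(\<Sum>j<n. d j) = t" for d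
  proof (cases "lowsum 2 n d \<le> B")
    case False
    have "\<not> lowsum 2 n (?up d j) \<le> B" if "j < n" for j
      using False that by (simp add: lowsum_upd) (smt (verit) zero_le_power2)
    then have "F (?up d j) = 0" "P (?up d j) = 1" if "j < n" for j using that by (auto simp: F_def P_def)
    then have "(\<Sum>j<n. F (?up d j)) = 0" "(\<Sum>j<n. P (?up d j)) = real n" by simp_all
    then show ?thesis using False n by (simp add: F_def P_def)
  next
    case True
    have "F d * \<rho> = (1 / real n) *\<^sub>R (\<Sum>j<n. W (?up d j))"
      using True lowprod_avg_step[OF n d, of "\<i> * complex_of_real z"] by (simp add: F_def W_def \<rho>_def)
    then have "(1 / real n) *\<^sub>R (\<Sum>j<n. F (?up d j)) - F d * \<rho> = (1 / real n) *\<^sub>R (\<Sum>j<n. F (?up d j) - W (?up d j))"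
      by (simp add: sum_subtractf scaleR_diff_right)
    then have "norm ((1 / real n) *\<^sub>R (\<Sum>j<n. F (?up d j)) - F d * \<rho>) = (1 / real n) * norm (\<Sum>j<n. F (?up d j) - W (?up d j))"
      by simp
    also have "\<dots> \<le> (1 / real n) * (\<Sum>j<n. C * P (?up d j))"
    proof (intro mult_left_mono order_trans[OF norm_sum] sum_mono)
      fix j assume "j \<in> {..<n}"
      then have j: "j < n" by simp
      show "norm (F (?up d j) - W (?up d j)) \<le> C * P (?up d j)"
      proof (cases "lowsum 2 n (?up d j) \<le> B")
        case False
        \<comment> \<open>From a value at most \<open>B\<close>, one throw adds at most
          \<open>2 * B + 2\<close>.\<close>
        have "lowsum 2 n (?up d j) \<le> 3 * B + 2"
          using deg_squared_le_lowsum_2[OF j, of d] True by (simp add: lowsum_upd[OF j])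
        then have "exp (z\<^sup>2 * lowsum 2 n (?up d j) / 2) \<le> C"
          unfolding C_def by (simp add: mult_left_mono)
        then show ?thesis using norm_lowprod_ii_le[of z n "?up d j"] False
          by (simp add: F_def P_def W_def)
      qed (simp add: F_def P_def)
    qed simp
    finally show ?thesis using True by (simp add: P_def sum_distrib_left[symmetric] mult.left_commute)
  qed
  \<comment> \<open>Each factor of \<open>w t\<close> has real part 1.\<close>
  have w1: "norm (w t) \<ge> 1" for t
  proof -
    have "1 \<le> norm (1 + \<i> * complex_of_real z * of_nat s / of_nat n)" for s
      using complex_Re_le_cmod[of "1 + \<i> * complex_of_real z * of_nat s / of_nat n"] by simp
    then show ?thesis unfolding w_def prod_norm[symmetric] by (intro prod_ge_1) auto
  qed
  have wS: "w (Suc t) = w t * \<rho>" by (simp add: w_def \<rho>_def)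
  have "norm (deg_avg n (Suc t) F - deg_avg n t F * \<rho>)
      = norm (deg_avg n t (\<lambda>d. (1 / real n) *\<^sub>R (\<Sum>j<n. F (?up d j)) - F d * \<rho>))"
    by (simp add: deg_avg_diff deg_avg_mult_right)
  also have "\<dots> \<le> deg_avg n t (\<lambda>d. C * ((1 / real n) * (\<Sum>j<n. P (?up d j)) - P d))"
    by (intro order_trans[OF norm_deg_avg_le] deg_avg_mono step)
  also have "\<dots> = C * (deg_avg n (Suc t) P - deg_avg n t P)"
    by (simp add: deg_avg_diff deg_avg_mult_left)
  finally have 1: "norm (deg_avg n (Suc t) F - deg_avg n t F * \<rho>) \<le> C * (deg_avg n (Suc t) P - deg_avg n t P)" .
  then have inc: "C * (deg_avg n (Suc t) P - deg_avg n t P) \<ge> 0" by (rule order_trans[OF norm_ge_zero])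
  have IH: "norm (deg_avg n t F - w t) \<le> C * norm (w t) * deg_avg n t P"
    using Suc.IH unfolding F_def P_def C_def W_def .
  have "norm (deg_avg n (Suc t) F - w (Suc t))
      = norm ((deg_avg n (Suc t) F - deg_avg n t F * \<rho>) + (deg_avg n t F - w t) * \<rho>)"
    by (simp add: wS algebra_simps)
  also have "\<dots> \<le> C * (deg_avg n (Suc t) P - deg_avg n t P) + (C * norm (w t) * deg_avg n t P) * norm \<rho>"
    by (intro order_trans[OF norm_triangle_ineq] add_mono 1) (simp only: norm_mult mult_right_mono[OF IH] norm_ge_zero)
  \<comment> \<open>The new error is enlarged by the factor \<open>norm (w (Suc t)) \<ge> 1\<close>,
    so that it shares a common factor with the propagated old error and the increments of the exit
    probability telescope.\<close>
  also have "\<dots> \<le> norm (w (Suc t)) * (C * (deg_avg n (Suc t) P - deg_avg n t P)) + (C * norm (w t) * deg_avg n t P) * norm \<rho>"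
    using mult_right_mono[OF w1[of "Suc t"] inc] by simp
  also have "\<dots> = C * norm (w (Suc t)) * deg_avg n (Suc t) P"
    by (simp add: wS norm_mult algebra_simps)
  finally show ?case unfolding F_def P_def C_def W_def .
qed

text \<open>Centred at the exact mean: each of the \<open>(k * n) choose 2\<close> pairs of balls
  shares a bin with probability \<open>1 / n\<close>.\<close>

definition clt_stat :: "nat \<Rightarrow> nat \<Rightarrow> (nat \<Rightarrow> nat) \<Rightarrow> real" where
  "clt_stat n k d = (lowsum 1 n d - real ((k * n) choose 2) / real n) / sqrt (real n)"

lemma sum_lessThan_choose_2: "(\<Sum>s<t. real s) = real (t choose 2)"
  by (induction t) (auto simp: real_choose_2 field_simps)

lemma exp_diff_le_max:
  fixes a b :: real
  assumes "a \<le> M" "b \<le> M"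
  shows "\<bar>exp a - exp b\<bar> \<le> exp M * \<bar>a - b\<bar>"
proof -
  have "norm (exp a - exp b) \<le> exp M * norm (a - b)"
    by (rule field_differentiable_bound[of "{..M}" exp exp])
       (use assms in \<open>auto intro!: derivative_eq_intros simp: has_field_derivative_at_within\<close>)
  then show ?thesis by simp
qed

lemma tendsto_scaled_sum_squares:
  "(\<lambda>n. (\<theta> / sqrt (real n))\<^sup>2 * (\<Sum>s<k*n. (real s)\<^sup>2) / (real n)\<^sup>2 / 2) \<longlonglongrightarrow> \<theta>\<^sup>2 * real k ^ 3 / 6"
proof -
  have "(\<lambda>n. \<theta>\<^sup>2 / real n * (2 * ((real k * real n) * (real k * real n - 1) * (real k * real n - 2) / 6)
      + (real k * real n) * (real k * real n - 1) / 2) / (real n)\<^sup>2 / 2) \<longlonglongrightarrow> \<theta>\<^sup>2 * real k ^ 3 / 6"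
    by (real_asymp simp: field_simps power2_eq_square power3_eq_cube)
  then show ?thesis by (simp add: sum_squares_choose real_choose_3 real_choose_2 power_divide)
qed

text \<open>Second-order expansion of the product formula: the linear term is the phase removed
  here, the quadratic one tends to \<open>\<theta>\<^sup>2 * k ^ 3 / 6\<close>, and the cubic error
  is at most of order \<open>1 / sqrt n\<close>.\<close>

lemma tendsto_deg_avg_lowprod_centered:
  fixes k :: nat and \<theta> :: real
  defines "z \<equiv> \<lambda>n. \<theta> / sqrt (real n)"
  defines "\<mu> \<equiv> \<lambda>n. real ((k * n) choose 2) / real n"
  shows "(\<lambda>n. deg_avg n (k * n) (lowprod (\<i> * complex_of_real (z n)) n) * exp (- (\<i> * complex_of_real (z n * \<mu> n))))
      \<longlonglongrightarrow> complex_of_real (exp (\<theta>\<^sup>2 * real k ^ 3 / 6))"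
proof -
  define w where "w = (\<lambda>n. deg_avg n (k * n) (lowprod (\<i> * complex_of_real (z n)) n))"
  define q where "q = (\<lambda>n. (z n)\<^sup>2 * (\<Sum>s<k*n. (real s)\<^sup>2) / (real n)\<^sup>2 / 2)"
  define v where "v = (\<lambda>n. w n * exp (- (\<i> * complex_of_real (z n * \<mu> n)) - complex_of_real (q n)))"
  have q: "q \<longlonglongrightarrow> \<theta>\<^sup>2 * real k ^ 3 / 6"
    unfolding q_def z_def by (rule tendsto_scaled_sum_squares)
  have "(\<lambda>n. v n - 1) \<longlonglongrightarrow> 0"
  proof (rule Lim_null_comparison)
    show "(\<lambda>n. (\<bar>\<theta>\<bar> / sqrt (real n)) ^ 3 * (real k * real n) ^ 4 / real n ^ 3) \<longlonglongrightarrow> 0"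
      by (cases "\<theta> = 0"; cases "k = 0") (simp_all, real_asymp)
    show "\<forall>\<^sub>F n in sequentially. norm (v n - 1) \<le> (\<bar>\<theta>\<bar> / sqrt (real n)) ^ 3 * (real k * real n) ^ 4 / real n ^ 3"
      using eventually_gt_at_top[of 0]
    proof eventually_elim
      case (elim n)
      have "norm (v n - 1) \<le> (\<Sum>s<k*n. \<bar>z n * real s / real n\<bar> ^ 3)"
      proof -
        have "(\<Sum>s<k*n. z n * real s / real n) = z n * \<mu> n"
          unfolding \<mu>_def sum_lessThan_choose_2[symmetric] by (simp add: sum_distrib_left sum_divide_distrib)
        moreover have "(\<Sum>s<k*n. (z n * real s / real n)\<^sup>2) / 2 = q n"
          unfolding q_def by (simp add: sum_distrib_left sum_divide_distrib power_mult_distrib power_divide)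
        moreover have "w n = (\<Prod>s<k*n. 1 + \<i> * complex_of_real (z n * real s / real n))"
          unfolding w_def deg_avg_lowprod[OF elim] by (simp add: algebra_simps)
        ultimately show ?thesis
          using norm_prod_one_plus_ii_exp_diff_le[of "{..<k*n}" "\<lambda>s. z n * real s / real n"]
          unfolding v_def by (simp only: finite_lessThan)
      qed
      also have "\<dots> = \<bar>z n\<bar> ^ 3 * (\<Sum>s<k*n. real s ^ 3) / real n ^ 3"
        by (simp add: abs_mult power_mult_distrib power_divide sum_distrib_left sum_divide_distrib)
      also have "\<dots> \<le> \<bar>z n\<bar> ^ 3 * real (k * n) ^ 4 / real n ^ 3"
        using sum_powers_le[of 3 "k * n"] by (intro divide_right_mono mult_left_mono) auto
      finally show ?case by (simp add: z_def)
    qed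
  qed
  then have "v \<longlonglongrightarrow> 1" by (simp add: LIM_zero_iff)
  then have "(\<lambda>n. v n * complex_of_real (exp (q n))) \<longlonglongrightarrow> 1 * complex_of_real (exp (\<theta>\<^sup>2 * real k ^ 3 / 6))"
    by (intro tendsto_intros q)
  moreover have "v n * complex_of_real (exp (q n)) = w n * exp (- (\<i> * complex_of_real (z n * \<mu> n)))" for n
    unfolding v_def by (simp add: exp_diff exp_of_real)
  ultimately show ?thesis unfolding w_def by simp
qed

text \<open>Up to a phase, \<open>lowprod\<close> is near \<open>G\<close> times the exponential
  sought wherever \<open>lowsum 2 / n\<close> is near its limit, and its average is known.
  Convergence of \<open>lowsum 2 / n\<close> in mean does not control the possibly very large
  modulus of the product elsewhere, so the product is first truncated.\<close>

lemma tendsto_char_clt_stat: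
  "(\<lambda>n. deg_avg n (k * n) (\<lambda>d. exp (\<i> * complex_of_real (\<theta> * clt_stat n k d))))
    \<longlonglongrightarrow> complex_of_real (exp (- (\<theta>\<^sup>2 * (real k)\<^sup>2 / 4)))"
proof -
  define c where "c = lowsum2_lim k"
  define E where "E = exp (\<theta>\<^sup>2 * (c + 1) / 2)"
  define z where "z = (\<lambda>n. \<theta> / sqrt (real n))"
  define \<mu> where "\<mu> = (\<lambda>n. real ((k * n) choose 2) / real n)"
  \<comment> \<open>The level lies \<open>n\<close> above the limiting value \<open>c * n\<close>,
    so exceeding it forces \<open>\<Delta> \<ge> 1\<close>; this gives
    \<open>P \<le> \<Delta>\<close>.\<close>
  define B where "B = (\<lambda>n. (c + 1) * real n)"
  define W where "W = (\<lambda>n. lowprod (\<i> * complex_of_real (z n)) n)"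
  define rot where "rot = (\<lambda>n. exp (- (\<i> * complex_of_real (z n * \<mu> n))))"
  define F where "F = (\<lambda>n d. if lowsum 2 n d \<le> B n then W n d else 0)"
  define P where "P = (\<lambda>n d. if lowsum 2 n d \<le> B n then 0 else 1 :: real)"
  define \<Delta> where "\<Delta> = (\<lambda>n d. \<bar>lowsum 2 n d / real n - c\<bar>)"
  define \<xi> where "\<xi> = (\<lambda>n d. exp (\<i> * complex_of_real (\<theta> * clt_stat n k d)))"
  have c: "c \<ge> 0" by (simp add: c_def lowsum2_lim_def)
  have norm_rot: "norm (rot n) = 1" for n by (simp add: rot_def)
  have z2: "(z n)\<^sup>2 = \<theta>\<^sup>2 / real n" for n by (simp add: z_def power_divide)
  have \<Delta>: "(\<lambda>n. deg_avg n (k * n) (\<Delta> n)) \<longlonglongrightarrow> 0"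
    unfolding \<Delta>_def c_def by (rule tendsto_deg_avg_lowsum_2)
  have P\<Delta>: "P n d \<le> \<Delta> n d" if "n > 0" for n d
  proof -
    have "\<not> lowsum 2 n d \<le> B n \<Longrightarrow> lowsum 2 n d / real n \<ge> c + 1"
      using that by (simp add: B_def field_simps)
    then show ?thesis by (auto simp: P_def \<Delta>_def)
  qed
  have lim_w: "(\<lambda>n. deg_avg n (k * n) (W n) * rot n) \<longlonglongrightarrow> complex_of_real (exp (\<theta>\<^sup>2 * real k ^ 3 / 6))"
    using tendsto_deg_avg_lowprod_centered[of k \<theta>] by (simp add: W_def rot_def z_def \<mu>_def)
  have lim_norm: "(\<lambda>n. norm (deg_avg n (k * n) (W n) * rot n)) \<longlonglongrightarrow> exp (\<theta>\<^sup>2 * real k ^ 3 / 6)"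
    using tendsto_norm[OF lim_w] by simp
  \<comment> \<open>The overshoot level \<open>3 * B + 2\<close> weighted by
    \<open>z\<^sup>2 = \<theta>\<^sup>2 / n\<close>, bounded uniformly in
    \<open>n \<ge> 1\<close>.\<close>
  define C where "C = exp (\<theta>\<^sup>2 * (3 * (c + 1) + 2) / 2)"
  have "(\<lambda>n. deg_avg n (k * n) (F n) * rot n - deg_avg n (k * n) (W n) * rot n) \<longlonglongrightarrow> 0"
  proof (rule Lim_null_comparison)
    show "(\<lambda>n. C * norm (deg_avg n (k * n) (W n) * rot n) * deg_avg n (k * n) (\<Delta> n)) \<longlonglongrightarrow> 0"
      using tendsto_mult[OF tendsto_mult[OF tendsto_const[of C] lim_norm] \<Delta>] by simp
    show "\<forall>\<^sub>F n in sequentially. norm (deg_avg n (k * n) (F n) * rot n - deg_avg n (k * n) (W n) * rot n)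
        \<le> C * norm (deg_avg n (k * n) (W n) * rot n) * deg_avg n (k * n) (\<Delta> n)"
      using eventually_gt_at_top[of 0]
    proof eventually_elim
      case (elim n)
      have "(z n)\<^sup>2 * (3 * B n + 2) \<le> \<theta>\<^sup>2 * (3 * (c + 1) + 2)"
      proof -
        have "(3 * B n + 2) / real n \<le> 3 * (c + 1) + 2" using elim by (simp add: B_def field_simps)
        then have "\<theta>\<^sup>2 * ((3 * B n + 2) / real n) \<le> \<theta>\<^sup>2 * (3 * (c + 1) + 2)" by (rule mult_left_mono) simp
        then show ?thesis by (simp add: z2)
      qed
      then have expC: "exp ((z n)\<^sup>2 * (3 * B n + 2) / 2) \<le> C" by (simp add: C_def)
      have "norm (deg_avg n (k * n) (F n) * rot n - deg_avg n (k * n) (W n) * rot n)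
          = norm (deg_avg n (k * n) (F n) - deg_avg n (k * n) (W n))"
        unfolding left_diff_distrib[symmetric] norm_mult norm_rot by simp
      also have "\<dots> \<le> exp ((z n)\<^sup>2 * (3 * B n + 2) / 2) * norm (deg_avg n (k * n) (W n)) * deg_avg n (k * n) (P n)"
        using norm_deg_avg_lowprod_truncated[OF elim, of "B n" "k * n" "z n"] c
        unfolding F_def W_def P_def deg_avg_lowprod[OF elim] by (simp add: B_def)
      also have "\<dots> \<le> C * norm (deg_avg n (k * n) (W n)) * deg_avg n (k * n) (\<Delta> n)"
        by (intro mult_mono mult_nonneg_nonneg deg_avg_mono P\<Delta> elim expC deg_avg_nonneg) (auto simp: C_def P_def)
      finally show ?case by (simp add: norm_mult norm_rot)
    qed
  qed
  from tendsto_add[OF this lim_w]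
  have lim_F: "(\<lambda>n. deg_avg n (k * n) (F n) * rot n) \<longlonglongrightarrow> complex_of_real (exp (\<theta>\<^sup>2 * real k ^ 3 / 6))" by simp

  \<comment> \<open>The value of \<open>exp (z\<^sup>2 * lowsum 2 / 2)\<close> once
    \<open>lowsum 2 / n\<close> is replaced by its limit \<open>c\<close>.\<close>
  define G where "G = exp (\<theta>\<^sup>2 * c / 2)"
  have GE: "G \<le> E" using c by (simp add: G_def E_def mult_left_mono)
  \<comment> \<open>The coefficient of \<open>\<Delta>\<close> covers both cases:
    \<open>\<theta>\<^sup>2 / 2\<close> is the cost of replacing \<open>lowsum 2 / n\<close> by
    \<open>c\<close> below the level, and 1 pays above it, where the error is
    \<open>G \<le> E\<close>.\<close>
  have pointwise: "norm (F n d * rot n - complex_of_real G * \<xi> n d)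
      \<le> (E * \<bar>\<theta>\<bar> ^ 3) * (lowsum 3 n d / (real n * sqrt (real n))) + (E * (\<theta>\<^sup>2 / 2 + 1)) * \<Delta> n d"
    if n: "n > 0" for n d
  proof (cases "lowsum 2 n d \<le> B n")
    case True
    define V where "V = W n d * exp (- (\<i> * complex_of_real (z n * lowsum 1 n d)) - complex_of_real ((z n)\<^sup>2 * lowsum 2 n d / 2))"
    define a where "a = (z n)\<^sup>2 * lowsum 2 n d / 2"
    have aM: "a \<le> \<theta>\<^sup>2 * (c + 1) / 2"
    proof -
      have "lowsum 2 n d / real n \<le> c + 1" using True n by (simp add: B_def field_simps)
      then have "\<theta>\<^sup>2 * (lowsum 2 n d / real n) \<le> \<theta>\<^sup>2 * (c + 1)" by (rule mult_left_mono) simp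
      then show ?thesis by (simp add: a_def z2)
    qed
    have arg: "\<theta> * clt_stat n k d = z n * lowsum 1 n d - z n * \<mu> n"
      unfolding clt_stat_def z_def \<mu>_def using n by (simp add: field_simps)
    have \<xi>: "\<xi> n d = exp (\<i> * complex_of_real (z n * lowsum 1 n d)) * rot n"
      unfolding \<xi>_def arg rot_def exp_add[symmetric] by (simp add: right_diff_distrib)
    have "W n d = V * exp (\<i> * complex_of_real (z n * lowsum 1 n d)) * complex_of_real (exp a)"
      unfolding V_def a_def exp_of_real[symmetric] mult.assoc exp_add[symmetric] by simp
    then have "F n d * rot n - complex_of_real G * \<xi> n d = (V * complex_of_real (exp a) - complex_of_real G) * \<xi> n d"
      using True by (simp add: F_def \<xi> algebra_simps)
    then have "norm (F n d * rot n - complex_of_real G * \<xi> n d) = norm (V * complex_of_real (exp a) - complex_of_real G)"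
      by (simp add: norm_mult \<xi>_def)
    also have "V * complex_of_real (exp a) - complex_of_real G = (V - 1) * complex_of_real (exp a) + complex_of_real (exp a - G)"
      by (simp add: algebra_simps)
    also have "norm \<dots> \<le> norm (V - 1) * exp a + \<bar>exp a - G\<bar>"
      by (rule order_trans[OF norm_triangle_ineq]) (simp only: norm_mult norm_of_real abs_exp_cancel order_refl)
    also have "\<dots> \<le> (\<bar>z n\<bar> ^ 3 * lowsum 3 n d) * E + E * \<bar>a - \<theta>\<^sup>2 * c / 2\<bar>"
      unfolding G_def E_def V_def W_def using aM c
      by (intro add_mono mult_mono exp_diff_le_max norm_lowprod_ii_exp_diff_le mult_nonneg_nonneg lowsum_nonneg)
         (auto simp: mult_left_mono)
    also have "a - \<theta>\<^sup>2 * c / 2 = (\<theta>\<^sup>2 / 2) * (lowsum 2 n d / real n - c)"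
      by (simp add: a_def z2 algebra_simps)
    also have "\<bar>\<dots>\<bar> = (\<theta>\<^sup>2 / 2) * \<Delta> n d" by (simp add: abs_mult \<Delta>_def)
    also have "\<bar>z n\<bar> ^ 3 * lowsum 3 n d = \<bar>\<theta>\<bar> ^ 3 * (lowsum 3 n d / (real n * sqrt (real n)))"
      using n by (simp add: z_def power_divide power3_eq_cube)
    also have "(\<bar>\<theta>\<bar> ^ 3 * (lowsum 3 n d / (real n * sqrt (real n)))) * E + E * ((\<theta>\<^sup>2 / 2) * \<Delta> n d)
        \<le> (E * \<bar>\<theta>\<bar> ^ 3) * (lowsum 3 n d / (real n * sqrt (real n))) + (E * (\<theta>\<^sup>2 / 2 + 1)) * \<Delta> n d"
      by (simp add: algebra_simps E_def \<Delta>_def)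
    finally show ?thesis .
  next
    case False
    have "norm (F n d * rot n - complex_of_real G * \<xi> n d) = G * P n d"
      using False by (simp add: F_def P_def norm_mult \<xi>_def G_def)
    also have "\<dots> \<le> E * \<Delta> n d"
      using GE P\<Delta>[OF n, of d] by (intro mult_mono) (auto simp: E_def P_def)
    also have "\<dots> \<le> (E * \<bar>\<theta>\<bar> ^ 3) * (lowsum 3 n d / (real n * sqrt (real n))) + (E * (\<theta>\<^sup>2 / 2 + 1)) * \<Delta> n d"
      by (simp add: algebra_simps E_def \<Delta>_def lowsum_nonneg)
    finally show ?thesis .
  qed
  have "(\<lambda>n. deg_avg n (k * n) (F n) * rot n - complex_of_real G * deg_avg n (k * n) (\<xi> n)) \<longlonglongrightarrow> 0"
  proof (rule Lim_null_comparison)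
    show "(\<lambda>n. (E * \<bar>\<theta>\<bar> ^ 3) * deg_avg n (k * n) (\<lambda>d. lowsum 3 n d / (real n * sqrt (real n)))
        + (E * (\<theta>\<^sup>2 / 2 + 1)) * deg_avg n (k * n) (\<Delta> n)) \<longlonglongrightarrow> 0"
      using tendsto_add[OF tendsto_mult[OF tendsto_const[of "E * \<bar>\<theta>\<bar> ^ 3"] tendsto_deg_avg_lowsum_3]
          tendsto_mult[OF tendsto_const[of "E * (\<theta>\<^sup>2 / 2 + 1)"] \<Delta>]] by simp
    show "\<forall>\<^sub>F n in sequentially. norm (deg_avg n (k * n) (F n) * rot n - complex_of_real G * deg_avg n (k * n) (\<xi> n))
        \<le> (E * \<bar>\<theta>\<bar> ^ 3) * deg_avg n (k * n) (\<lambda>d. lowsum 3 n d / (real n * sqrt (real n)))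
        + (E * (\<theta>\<^sup>2 / 2 + 1)) * deg_avg n (k * n) (\<Delta> n)"
      using eventually_gt_at_top[of 0]
    proof eventually_elim
      case (elim n)
      have "norm (deg_avg n (k * n) (F n) * rot n - complex_of_real G * deg_avg n (k * n) (\<xi> n))
          = norm (deg_avg n (k * n) (\<lambda>d. F n d * rot n - complex_of_real G * \<xi> n d))"
        by (simp only: deg_avg_diff deg_avg_mult_left deg_avg_mult_right)
      also have "\<dots> \<le> deg_avg n (k * n) (\<lambda>d. (E * \<bar>\<theta>\<bar> ^ 3) * (lowsum 3 n d / (real n * sqrt (real n))) + (E * (\<theta>\<^sup>2 / 2 + 1)) * \<Delta> n d)"
        by (intro order_trans[OF norm_deg_avg_le] deg_avg_mono pointwise elim)
      finally show ?case by (simp only: deg_avg_add deg_avg_mult_left)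
    qed
  qed
  from tendsto_diff[OF lim_F this]
  have "(\<lambda>n. complex_of_real G * deg_avg n (k * n) (\<xi> n)) \<longlonglongrightarrow> complex_of_real (exp (\<theta>\<^sup>2 * real k ^ 3 / 6))" by simp
  from tendsto_mult[OF tendsto_const[of "complex_of_real (inverse G)"] this]
  have "(\<lambda>n. deg_avg n (k * n) (\<xi> n)) \<longlonglongrightarrow> complex_of_real (inverse G * exp (\<theta>\<^sup>2 * real k ^ 3 / 6))"
    by (simp add: G_def mult.assoc[symmetric])
  \<comment> \<open>The cubic terms cancel: half of \<open>c\<close> is
    \<open>k ^ 3 / 6 + k ^ 2 / 4\<close>.\<close>
  also have "inverse G * exp (\<theta>\<^sup>2 * real k ^ 3 / 6) = exp (- (\<theta>\<^sup>2 * (real k)\<^sup>2 / 4))"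
    unfolding G_def c_def lowsum2_lim_def exp_minus[symmetric] exp_add[symmetric]
    by (simp add: field_simps)
  finally show ?thesis unfolding \<xi>_def .
qed

section \<open>The Gaussian limit\<close>

lemma finite_kout_maps: "finite (kout_maps n k)"
  unfolding kout_maps_def by (intro finite_PiE) auto

lemma kout_maps_nonempty: "kout_maps n k \<noteq> {}"
  unfolding kout_maps_def by (auto simp: PiE_eq_empty_iff)

lemma card_kout_maps: "n > 0 \<Longrightarrow> card (kout_maps n k) = n ^ (k * n)"
  using sum_kout_maps[of n "\<lambda>_. 1 :: real" k] by (simp add: deg_avg_const flip: of_nat_power)

lemma integral_pmf_of_kout_maps:
  fixes f :: "(nat \<Rightarrow> nat) \<Rightarrow> 'b::{banach, second_countable_topology}"
  assumes "n > 0"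
  shows "(LINT M|measure_pmf (pmf_of_set (kout_maps n k)). f (indeg n k M)) = deg_avg n (k * n) f"
proof -
  have "(LINT M|measure_pmf (pmf_of_set (kout_maps n k)). f (indeg n k M))
      = (\<Sum>M\<in>kout_maps n k. pmf (pmf_of_set (kout_maps n k)) M *\<^sub>R f (indeg n k M))"
    by (rule integral_measure_pmf) (auto simp: finite_kout_maps kout_maps_nonempty)
  also have "\<dots> = (1 / real (card (kout_maps n k))) *\<^sub>R (\<Sum>M\<in>kout_maps n k. f (indeg n k M))"
    unfolding scaleR_sum_right by (intro sum.cong) (auto simp: finite_kout_maps kout_maps_nonempty)
  finally show ?thesis using assms by (simp add: sum_kout_maps card_kout_maps)
qed

text \<open>Levy's continuity theorem; the limit law is the centred Gaussian with variance
  \<open>k ^ 2 / 2\<close>. Being symmetric, it can be written with a minus sign in front of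
  \<open>z\<close>, which later produces \<open>exp (- N)\<close>.\<close>

lemma tendsto_deg_avg_bounded_continuous:
  fixes h :: "real \<Rightarrow> real"
  assumes cont: "\<And>x. isCont h x" and bdd: "\<And>x. \<bar>h x\<bar> \<le> B"
  shows "(\<lambda>n. deg_avg n (k * n) (\<lambda>d. h (clt_stat n k d)))
    \<longlonglongrightarrow> (LINT z|lborel. std_normal_density z * h (- (real k / sqrt 2 * z)))"
proof -
  define \<sigma> where "\<sigma> = real k / sqrt 2"
  define Mn where "Mn = (\<lambda>n. distr (measure_pmf (pmf_of_set (kout_maps n k))) borel (\<lambda>M. clt_stat n k (indeg n k M)))"
  define N where "N = distr std_normal_distribution borel (\<lambda>z. - (\<sigma> * z))"
  interpret std: real_distribution std_normal_distribution by (rule real_dist_normal_dist)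
  have [measurable]: "h \<in> borel_measurable borel"
    by (intro borel_measurable_continuous_onI continuous_at_imp_continuous_on) (simp add: cont)
  have Mn: "real_distribution (Mn n)" for n
    unfolding Mn_def by (intro prob_space.real_distribution_distr prob_space_measure_pmf) auto
  have N: "real_distribution N"
    unfolding N_def by (intro std.real_distribution_distr) measurable
  have int_Mn: "integral\<^sup>L (Mn n) f = deg_avg n (k * n) (\<lambda>d. f (clt_stat n k d))"
    if "n > 0" "f \<in> borel_measurable borel" for n and f :: "real \<Rightarrow> 'b::{banach, second_countable_topology}"
    unfolding Mn_def using that integral_pmf_of_kout_maps[OF that(1), of k "\<lambda>d. f (clt_stat n k d)"]
    by (subst integral_distr) auto
  have "(\<lambda>n. char (Mn n) t) \<longlonglongrightarrow> char N t" for t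
  proof -
    have "char N t = (CLINT z|std_normal_distribution. iexp (t * - (\<sigma> * z)))"
      unfolding N_def char_def by (subst integral_distr) auto
    also have "\<dots> = char std_normal_distribution (- (t * \<sigma>))"
      unfolding char_def by (simp add: mult.assoc)
    also have "\<dots> = complex_of_real (exp (- (t\<^sup>2 * (real k)\<^sup>2 / 4)))"
      by (simp add: char_std_normal_distribution \<sigma>_def power_divide power_mult_distrib)
    finally have charN: "char N t = complex_of_real (exp (- (t\<^sup>2 * (real k)\<^sup>2 / 4)))" .
    have "\<forall>\<^sub>F n in sequentially. deg_avg n (k * n) (\<lambda>d. exp (\<i> * complex_of_real (t * clt_stat n k d))) = char (Mn n) t"
      using eventually_gt_at_top[of 0]
    proof eventually_elim
      case (elim n)
      then show ?case unfolding char_def by (subst int_Mn) auto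
    qed
    then show ?thesis unfolding charN by (rule Lim_transform_eventually[OF tendsto_char_clt_stat])
  qed
  then have "weak_conv_m Mn N" by (intro levy_continuity Mn N)
  then have "(\<lambda>n. integral\<^sup>L (Mn n) h) \<longlonglongrightarrow> integral\<^sup>L N h"
    using Mn N by (intro weak_conv_imp_integral_bdd_continuous_conv[of Mn N h B]) (auto simp: cont bdd)
  moreover have "integral\<^sup>L N h = (LINT z|lborel. std_normal_density z * h (- (\<sigma> * z)))"
    unfolding N_def by (simp add: integral_distr integral_density)
  moreover have "\<forall>\<^sub>F n in sequentially. integral\<^sup>L (Mn n) h = deg_avg n (k * n) (\<lambda>d. h (clt_stat n k d))"
    using eventually_gt_at_top[of 0] by eventually_elim (simp add: int_Mn)
  ultimately show ?thesis unfolding \<sigma>_def by (simp add: Lim_transform_eventually)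
qed

text \<open>Completing the square: the tilted density is the standard one shifted by
  \<open>\<tau>\<close>. Thus \<open>exp (- N)\<close> has mean one whenever the mean of the
  Gaussian \<open>N\<close> is half its variance.\<close>

lemma has_bochner_integral_std_normal_tilt:
  "has_bochner_integral lborel (\<lambda>z. std_normal_density z * exp (- (\<tau>\<^sup>2 / 2 + \<tau> * z))) 1"
proof -
  have "has_bochner_integral lborel std_normal_density 1"
    by (simp add: has_bochner_integral_iff integrable_normal_density integral_normal_density)
  then have "has_bochner_integral lborel (\<lambda>z. std_normal_density (\<tau> + 1 * z)) 1"
    by (subst (asm) lborel_has_bochner_integral_real_affine_iff[of 1 _ _ \<tau>]) auto
  also have "(\<lambda>z. std_normal_density (\<tau> + 1 * z)) = (\<lambda>z. std_normal_density z * exp (- (\<tau>\<^sup>2 / 2 + \<tau> * z)))"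
    by (simp add: std_normal_density_def exp_add[symmetric] fun_eq_iff power2_eq_square field_simps)
  finally show ?thesis .
qed

text \<open>Since \<open>J\<close> has mean one, the positive and negative parts of
  \<open>1 - J\<close> have equal means, each half of \<open>I\<close>. The negative part is
  unbounded; it is reached through bounded truncations, to which weak convergence applies.\<close>

lemma std_normal_tilt_half_abs:
  fixes \<tau> :: real
  defines "J \<equiv> \<lambda>z. exp (- (\<tau>\<^sup>2 / 2 + \<tau> * z))"
  defines "I \<equiv> LINT z|lborel. std_normal_density z * \<bar>1 - J z\<bar>"
  shows "(LINT z|lborel. std_normal_density z * (1 - min (J z) 1)) = I / 2"
    and "(\<lambda>m. LINT z|lborel. std_normal_density z * max 0 (min (J z) (real m) - 1)) \<longlonglongrightarrow> I / 2"
proof -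
  have [measurable]: "J \<in> borel_measurable borel" unfolding J_def by measurable
  have intJ: "integrable lborel (\<lambda>z. std_normal_density z * J z)" "(LINT z|lborel. std_normal_density z * J z) = 1"
    using has_bochner_integral_std_normal_tilt[of \<tau>] unfolding J_def by (auto simp: has_bochner_integral_iff)
  have int1: "integrable lborel std_normal_density" "(LINT z|lborel. std_normal_density z) = 1"
    by (auto simp: integral_normal_density)
  define D where "D = (\<lambda>z. std_normal_density z * (1 - J z))"
  have D: "integrable lborel D" "integral\<^sup>L lborel D = 0"
    using intJ int1 by (simp_all add: D_def right_diff_distrib)
  have absD: "\<bar>D z\<bar> = std_normal_density z * \<bar>1 - J z\<bar>" for z
    by (simp add: D_def abs_mult)
  have intabs: "integrable lborel (\<lambda>z. \<bar>D z\<bar>)" "(LINT z|lborel. \<bar>D z\<bar>) = I"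
    using D(1) by (simp, simp add: absD I_def)
  have "std_normal_density z * (1 - min (J z) 1) = (\<bar>D z\<bar> + D z) / 2" for z
    unfolding absD unfolding D_def distrib_left[symmetric] times_divide_eq_right[symmetric]
    by (intro arg_cong[where f="times _"]) (auto simp: min_def abs_if field_simps)
  then have "(LINT z|lborel. std_normal_density z * (1 - min (J z) 1)) = (LINT z|lborel. (\<bar>D z\<bar> + D z) / 2)" by (simp only:)
  also have "\<dots> = I / 2" using D intabs by simp
  finally show "(LINT z|lborel. std_normal_density z * (1 - min (J z) 1)) = I / 2" .
  have pos: "std_normal_density z * max 0 (J z - 1) = (\<bar>D z\<bar> - D z) / 2" for z
    unfolding absD unfolding D_def right_diff_distrib[symmetric] times_divide_eq_right[symmetric]
    by (intro arg_cong[where f="times _"]) (auto simp: max_def abs_if field_simps)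
  have "(LINT z|lborel. std_normal_density z * max 0 (J z - 1)) = (LINT z|lborel. (\<bar>D z\<bar> - D z) / 2)"
    by (simp only: pos)
  also have "\<dots> = I / 2" using D intabs by simp
  finally have lim: "(LINT z|lborel. std_normal_density z * max 0 (J z - 1)) = I / 2" .
  have "(\<lambda>m. LINT z|lborel. std_normal_density z * max 0 (min (J z) (real m) - 1))
      \<longlonglongrightarrow> (LINT z|lborel. std_normal_density z * max 0 (J z - 1))"
  proof (rule integral_dominated_convergence[where w="\<lambda>z. \<bar>D z\<bar>"])
    show "AE z in lborel. (\<lambda>m. std_normal_density z * max 0 (min (J z) (real m) - 1)) \<longlonglongrightarrow> std_normal_density z * max 0 (J z - 1)"
    proof (intro AE_I2 tendsto_eventually)
      fix z
      obtain m0 where m0: "J z \<le> real m0" using real_arch_simple by blast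
      show "\<forall>\<^sub>F m in sequentially. std_normal_density z * max 0 (min (J z) (real m) - 1) = std_normal_density z * max 0 (J z - 1)"
        using eventually_ge_at_top[of m0] by eventually_elim (use m0 in \<open>simp add: min_def\<close>)
    qed
    show "AE z in lborel. norm (std_normal_density z * max 0 (min (J z) (real m) - 1)) \<le> \<bar>D z\<bar>" for m
      unfolding absD by (intro AE_I2) (auto simp: abs_mult intro!: mult_left_mono)
  qed (use intabs in auto)
  then show "(\<lambda>m. LINT z|lborel. std_normal_density z * max 0 (min (J z) (real m) - 1)) \<longlonglongrightarrow> I / 2"
    unfolding lim .
qed

section \<open>Total variation distance\<close>

text \<open>The fibre sums \<open>s\<close> add up to 0 and
  \<open>\<bar>s\<bar> = s + 2 * max 0 (- s)\<close>, so half the sum of absolute values is the sum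
  of the negative parts, which \<open>b\<close> dominates.\<close>

lemma half_sum_abs_le:
  fixes f b :: "'a \<Rightarrow> real"
  assumes "finite \<Omega>" "(\<Sum>M\<in>\<Omega>. f M) = 0"
    and "\<And>M. M \<in> \<Omega> \<Longrightarrow> - f M \<le> b M" "\<And>M. M \<in> \<Omega> \<Longrightarrow> 0 \<le> b M"
  shows "(1/2) * (\<Sum>x\<in>X ` \<Omega>. \<bar>\<Sum>M\<in>{M\<in>\<Omega>. X M = x}. f M\<bar>) \<le> (\<Sum>M\<in>\<Omega>. b M)"
proof -
  let ?S = "\<lambda>h x. \<Sum>M\<in>{M\<in>\<Omega>. X M = x}. h M :: real"
  have "(\<Sum>x\<in>X ` \<Omega>. \<bar>?S f x\<bar>) \<le> (\<Sum>x\<in>X ` \<Omega>. 2 * ?S b x + ?S f x)"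
  proof (rule sum_mono)
    fix x
    have "- ?S f x \<le> ?S b x" unfolding sum_negf[symmetric] by (intro sum_mono) (auto simp: assms)
    moreover have "0 \<le> ?S b x" by (intro sum_nonneg) (auto simp: assms)
    ultimately show "\<bar>?S f x\<bar> \<le> 2 * ?S b x + ?S f x" by linarith
  qed
  also have "\<dots> = 2 * (\<Sum>M\<in>\<Omega>. b M) + (\<Sum>M\<in>\<Omega>. f M)"
    using sum.image_gen[OF assms(1), of b X] sum.image_gen[OF assms(1), of f X]
    by (simp add: sum.distrib sum_distrib_left[symmetric])
  finally show ?thesis using assms(2) by simp
qed

text \<open>The difference of two laws on any event bounds their total variation distance from
  below. The event \<open>A\<close> depends on the value of \<open>X\<close> alone, so that it is a
  union of fibres.\<close>

lemma half_sum_abs_ge: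
  fixes f c :: "'a \<Rightarrow> real"
  assumes "finite \<Omega>" "(\<Sum>M\<in>\<Omega>. f M) = 0"
    and "\<And>M. M \<in> \<Omega> \<Longrightarrow> c M \<le> (if A (X M) then f M else 0)"
  shows "(\<Sum>M\<in>\<Omega>. c M) \<le> (1/2) * (\<Sum>x\<in>X ` \<Omega>. \<bar>\<Sum>M\<in>{M\<in>\<Omega>. X M = x}. f M\<bar>)"
proof -
  let ?S = "\<lambda>h x. \<Sum>M\<in>{M\<in>\<Omega>. X M = x}. h M :: real"
  have "2 * (\<Sum>M\<in>\<Omega>. c M) - (\<Sum>M\<in>\<Omega>. f M) = (\<Sum>x\<in>X ` \<Omega>. 2 * ?S c x - ?S f x)"
    using sum.image_gen[OF assms(1), of c X] sum.image_gen[OF assms(1), of f X]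
    by (simp add: sum_subtractf sum_distrib_left[symmetric])
  also have "\<dots> \<le> (\<Sum>x\<in>X ` \<Omega>. \<bar>?S f x\<bar>)"
  proof (rule sum_mono)
    fix x
    have "?S c x \<le> (\<Sum>M\<in>{M\<in>\<Omega>. X M = x}. if A x then f M else 0)"
    proof (rule sum_mono)
      fix M assume "M \<in> {M\<in>\<Omega>. X M = x}"
      then show "c M \<le> (if A x then f M else 0)" using assms(3)[of M] by auto
    qed
    then show "2 * ?S c x - ?S f x \<le> \<bar>?S f x\<bar>" by (cases "A x") auto
  qed
  finally show ?thesis using assms(2) by simp
qed

lemma sum_indeg:
  assumes "M \<in> kout_maps n k"
  shows "(\<Sum>j<n. indeg n k M j) = k * n"
proof -
  have "(\<Sum>j<n. indeg n k M j) = card (\<Union>j<n. {(i, l). i < n \<and> l < k \<and> M i l = j})"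
    unfolding indeg_def
  proof (rule card_UN_disjoint[symmetric])
    have "finite ({..<n} \<times> {..<k})" by simp
    then show "\<forall>j\<in>{..<n}. finite {(i, l). i < n \<and> l < k \<and> M i l = j}"
      by (blast intro: finite_subset[rotated])
  qed auto
  also have "(\<Union>j<n. {(i, l). i < n \<and> l < k \<and> M i l = j}) = {..<n} \<times> {..<k}"
    using assms unfolding kout_maps_def by (auto simp: PiE_iff)
  finally show ?thesis by (simp add: mult.commute)
qed

section \<open>Second-order bounds for the likelihood ratio\<close>

lemma ln_one_plus_cubic_bounds:
  fixes y :: real
  assumes "y \<ge> 0"
  shows "y - y\<^sup>2 / 2 \<le> ln (1 + y)" "ln (1 + y) \<le> y - y\<^sup>2 / 2 + y ^ 3 / 3"
proof -
  have "ln (1 + 0) - 0 + 0\<^sup>2 / 2 \<le> ln (1 + y) - y + y\<^sup>2 / 2"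
  proof (rule DERIV_nonneg_imp_nondecreasing[OF assms])
    fix x :: real assume x: "0 \<le> x"
    have "((\<lambda>x. ln (1 + x) - x + x\<^sup>2 / 2) has_real_derivative x\<^sup>2 / (1 + x)) (at x)"
      using x by (auto intro!: derivative_eq_intros simp: field_simps power2_eq_square)
    then show "\<exists>D. ((\<lambda>x. ln (1 + x) - x + x\<^sup>2 / 2) has_real_derivative D) (at x) \<and> 0 \<le> D" using x by force
  qed
  then show "y - y\<^sup>2 / 2 \<le> ln (1 + y)" by simp
  have "0 - 0\<^sup>2 / 2 + 0 ^ 3 / 3 - ln (1 + 0) \<le> y - y\<^sup>2 / 2 + y ^ 3 / 3 - ln (1 + y)"
  proof (rule DERIV_nonneg_imp_nondecreasing[OF assms])
    fix x :: real assume x: "0 \<le> x"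
    have "((\<lambda>x. x - x\<^sup>2 / 2 + x ^ 3 / 3 - ln (1 + x)) has_real_derivative x ^ 3 / (1 + x)) (at x)"
      using x by (auto intro!: derivative_eq_intros simp: field_simps power2_eq_square power3_eq_cube)
    then show "\<exists>D. ((\<lambda>x. x - x\<^sup>2 / 2 + x ^ 3 / 3 - ln (1 + x)) has_real_derivative D) (at x) \<and> 0 \<le> D" using x by force
  qed
  then show "ln (1 + y) \<le> y - y\<^sup>2 / 2 + y ^ 3 / 3" by simp
qed

lemma exp_cubic_bounds:
  fixes y :: real
  assumes "y \<ge> 0"
  shows "exp (y - y\<^sup>2 / 2) \<le> 1 + y" "1 + y \<le> exp (y - y\<^sup>2 / 2 + y ^ 3 / 3)"
proof -
  have "exp (ln (1 + y)) = 1 + y" using assms by simp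
  then show "exp (y - y\<^sup>2 / 2) \<le> 1 + y" "1 + y \<le> exp (y - y\<^sup>2 / 2 + y ^ 3 / 3)"
    using ln_one_plus_cubic_bounds[OF assms] by (metis exp_le_cancel_iff)+
qed

text \<open>This is for the numerator of the likelihood ratio: the lower Taylor bound has no cubic
  term, and it suffices because the ratio is only bounded from below.\<close>

lemma lowprod_ge_exp:
  fixes x :: real
  assumes "x \<ge> 0"
  shows "lowprod x n d \<ge> exp (x * lowsum 1 n d - x\<^sup>2 * lowsum 2 n d / 2)"
proof -
  let ?I = "Sigma {..<n} (\<lambda>j. {..<d j})"
  have "exp (x * lowsum 1 n d - x\<^sup>2 * lowsum 2 n d / 2) = exp (\<Sum>s\<in>?I. x * real (snd s) - (x * real (snd s))\<^sup>2 / 2)"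
    using lowsum_scaled_Sigma[where c=x and p=1 and n=n and d=d] lowsum_scaled_Sigma[where c="x\<^sup>2" and p=2 and n=n and d=d]
    by (simp add: sum_subtractf sum_divide_distrib[symmetric] case_prod_unfold power_mult_distrib)
  also have "\<dots> \<le> (\<Prod>s\<in>?I. 1 + x * real (snd s))"
    by (subst exp_sum) (auto intro!: prod_mono exp_cubic_bounds mult_nonneg_nonneg assms)
  also have "\<dots> = lowprod x n d" unfolding lowprod_Sigma by (simp add: case_prod_unfold)
  finally show ?thesis .
qed

text \<open>This is for the denominator of the likelihood ratio. Its cubic term is deterministic,
  and with \<open>x\<close> of order \<open>1 / (n * sqrt n)\<close> and \<open>t = k * n\<close>
  the crude \<open>t ^ 4\<close> still gives a vanishing error.\<close>

lemma prod_one_plus_le_exp: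
  fixes x :: real
  assumes "x \<ge> 0"
  shows "(\<Prod>s<t. 1 + x * real s) \<le> exp (x * real (t choose 2) - x\<^sup>2 * (\<Sum>s<t. (real s)\<^sup>2) / 2 + x ^ 3 * real t ^ 4 / 3)"
proof -
  have "(\<Prod>s<t. 1 + x * real s) \<le> (\<Prod>s<t. exp (x * real s - (x * real s)\<^sup>2 / 2 + (x * real s) ^ 3 / 3))"
    using assms by (intro prod_mono) (auto intro!: exp_cubic_bounds)
  also have "\<dots> = exp (x * real (t choose 2) - x\<^sup>2 * (\<Sum>s<t. (real s)\<^sup>2) / 2 + x ^ 3 * (\<Sum>s<t. real s ^ 3) / 3)"
    unfolding sum_lessThan_choose_2[symmetric]
    by (simp add: exp_sum[symmetric] sum.distrib sum_subtractf sum_distrib_left sum_divide_distrib power_mult_distrib)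
  also have "\<dots> \<le> exp (x * real (t choose 2) - x\<^sup>2 * (\<Sum>s<t. (real s)\<^sup>2) / 2 + x ^ 3 * real t ^ 4 / 3)"
    using assms sum_powers_le[of 3 t] by (simp add: mult_left_mono)
  finally show ?thesis .
qed

lemma pochhammer_eq_power_prod:
  fixes \<alpha> :: real
  assumes "\<alpha> \<noteq> 0"
  shows "pochhammer \<alpha> b = \<alpha> ^ b * (\<Prod>a<b. 1 + real a / \<alpha>)"
  using assms by (induction b) (simp_all add: pochhammer_rec' field_simps)

text \<open>After cancellation of the powers of \<open>\<alpha>\<close> and \<open>n\<close> this is
  \<open>prob_alpha / prob_unif\<close>, that is, \<open>lowprod\<close> divided by its own
  average.\<close>

definition lratio :: "nat \<Rightarrow> nat \<Rightarrow> real \<Rightarrow> (nat \<Rightarrow> nat) \<Rightarrow> real" where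
  "lratio n k \<alpha> d = lowprod (1 / \<alpha>) n d / (\<Prod>s<k*n. 1 + 1 / \<alpha> * real s / real n)"

lemma prob_alpha_eq_lratio:
  assumes "M \<in> kout_maps n k" "n > 0" "\<alpha> > 0"
  shows "prob_alpha n k \<alpha> M = prob_unif n k M * lratio n k \<alpha> (indeg n k M)"
proof -
  have "(\<Prod>j<n. pochhammer \<alpha> (indeg n k M j)) = \<alpha> ^ (k * n) * lowprod (1 / \<alpha>) n (indeg n k M)"
    using assms(3) by (simp add: pochhammer_eq_power_prod prod.distrib lowprod_def power_sum[symmetric] sum_indeg[OF assms(1)])
  moreover have "pochhammer (\<alpha> * real n) (k * n) = \<alpha> ^ (k * n) * real n ^ (k * n) * (\<Prod>s<k*n. 1 + 1 / \<alpha> * real s / real n)"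
    using assms by (subst pochhammer_eq_power_prod) (auto simp: power_mult_distrib)
  ultimately show ?thesis
    using assms unfolding prob_alpha_def prob_unif_def lratio_def by simp
qed

lemma deg_avg_lratio:
  assumes "n > 0" "\<alpha> > 0"
  shows "deg_avg n (k * n) (lratio n k \<alpha>) = 1"
proof -
  define D where "D = (\<Prod>s<k*n. 1 + 1 / \<alpha> * real s / real n)"
  have "D > 0" using assms unfolding D_def by (intro prod_pos) (auto intro: add_pos_nonneg)
  moreover have "deg_avg n (k * n) (lratio n k \<alpha>) = deg_avg n (k * n) (lowprod (1 / \<alpha>) n) * inverse D"
    unfolding lratio_def D_def[symmetric] divide_inverse[of _ D] by (rule deg_avg_mult_right)
  ultimately show ?thesis
    using deg_avg_lowprod[OF assms(1), of "k * n" "1 / \<alpha>"] unfolding D_def[symmetric] by simp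
qed

text \<open>Since the in-degrees add up to \<open>k * n\<close>, the number of colliding pairs is an
  affine function of \<open>X\<close>; a function of \<open>clt_stat\<close> is thus a function of
  \<open>X\<close>.\<close>

lemma clt_stat_indeg:
  assumes "M \<in> kout_maps n k"
  shows "clt_stat n k (indeg n k M) = ((real (Xstat n k M) - real (k * n)) / 2 - real ((k * n) choose 2) / real n) / sqrt (real n)"
proof -
  let ?d = "indeg n k M"
  have "2 * lowsum 1 n ?d = (\<Sum>j<n. (real (?d j))\<^sup>2 - real (?d j))"
    unfolding lowsum_def sum_distrib_left
    by (intro sum.cong refl) (simp add: sum_distrib_left[symmetric] sum_lessThan_choose_2 real_choose_2 power2_eq_square right_diff_distrib)
  also have "\<dots> = real (Xstat n k M) - real (k * n)"
    unfolding Xstat_def sum_indeg[OF assms, symmetric] by (simp add: sum_subtractf)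
  finally have "lowsum 1 n ?d = (real (Xstat n k M) - real (k * n)) / 2" by simp
  then show ?thesis unfolding clt_stat_def by (simp only:)
qed

lemma sum_prob_unif_mult:
  assumes "n > 0"
  shows "(\<Sum>M\<in>kout_maps n k. prob_unif n k M * f (indeg n k M)) = deg_avg n (k * n) f"
  unfolding prob_unif_def sum_distrib_left[symmetric] sum_kout_maps[OF assms] using assms by simp

lemma dTV_X_eq:
  "dTV_X n k \<alpha> = (1/2) * (\<Sum>x\<in>Xstat n k ` kout_maps n k.
     \<bar>\<Sum>M\<in>{M\<in>kout_maps n k. Xstat n k M = x}. prob_alpha n k \<alpha> M - prob_unif n k M\<bar>)"
  unfolding dTV_X_def PX_alpha_def PX_unif_def by (simp add: sum_subtractf)

text \<open>The likelihood ratio is compared with a function of \<open>X\<close> alone; only a one-sided comparison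
  is needed because both the ratio and its Gaussian limit have mean one.\<close>
lemma dTV_X_bounds:
  fixes g \<eta> :: "(nat \<Rightarrow> nat) \<Rightarrow> real" and m :: nat
  assumes n: "n > 0" and \<alpha>: "\<alpha> > 0" and m: "m \<ge> 1"
    and g: "\<And>M. M \<in> kout_maps n k \<Longrightarrow> g (indeg n k M) = G (Xstat n k M)" and g0: "\<And>d. g d > 0"
    and \<eta>: "\<And>d. \<eta> d \<ge> 0" and L: "\<And>d. lratio n k \<alpha> d \<ge> g d * exp (- \<eta> d)"
  shows "dTV_X n k \<alpha> \<le> deg_avg n (k * n) (\<lambda>d. 1 - min (g d) 1) + deg_avg n (k * n) \<eta>"
    and "deg_avg n (k * n) (\<lambda>d. max 0 (min (g d) (real m) - 1)) - real m * deg_avg n (k * n) \<eta> \<le> dTV_X n k \<alpha>"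
proof -
  define f where "f = (\<lambda>M. prob_alpha n k \<alpha> M - prob_unif n k M)"
  have u0: "prob_unif n k M \<ge> 0" for M by (simp add: prob_unif_def)
  have f: "f M = prob_unif n k M * (lratio n k \<alpha> (indeg n k M) - 1)" if "M \<in> kout_maps n k" for M
    unfolding f_def prob_alpha_eq_lratio[OF that n \<alpha>] by (simp add: algebra_simps)
  have "(\<Sum>M\<in>kout_maps n k. f M) = deg_avg n (k * n) (\<lambda>d. lratio n k \<alpha> d - 1)"
    unfolding sum_prob_unif_mult[OF n, symmetric] by (intro sum.cong f refl)
  also have "\<dots> = 0" by (simp add: deg_avg_diff deg_avg_lratio n \<alpha> deg_avg_const)
  finally have total: "(\<Sum>M\<in>kout_maps n k. f M) = 0" .
  \<comment> \<open>Truncation at \<open>r\<close> turns the relative error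
    \<open>1 - exp (- \<eta> d)\<close> into an additive one; the upper bound takes
    \<open>r = 1\<close> and the lower bound \<open>r = m\<close>.\<close>
  have key: "min (g d) (real r) - lratio n k \<alpha> d \<le> real r * \<eta> d" for d and r :: nat
  proof -
    have "min (g d) (real r) * exp (- \<eta> d) \<le> lratio n k \<alpha> d"
      by (rule order_trans[OF mult_right_mono L]) auto
    then have "min (g d) (real r) - lratio n k \<alpha> d \<le> min (g d) (real r) * (1 - exp (- \<eta> d))"
      by (simp add: right_diff_distrib)
    also have "\<dots> \<le> real r * \<eta> d"
    proof (rule mult_mono)
      show "1 - exp (- \<eta> d) \<le> \<eta> d" using exp_ge_add_one_self[of "- \<eta> d"] by simp
    qed (use \<eta>[of d] in auto)
    finally show ?thesis .
  qed
  have "dTV_X n k \<alpha> \<le> (\<Sum>M\<in>kout_maps n k. prob_unif n k M * (1 - min (g (indeg n k M)) 1 + \<eta> (indeg n k M)))"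
    unfolding dTV_X_eq f_def[symmetric]
  proof (rule half_sum_abs_le[OF finite_kout_maps total])
    fix M assume M: "M \<in> kout_maps n k"
    let ?d = "indeg n k M"
    have "- f M = prob_unif n k M * (1 - lratio n k \<alpha> ?d)" unfolding f[OF M] by (simp add: algebra_simps)
    also have "\<dots> \<le> prob_unif n k M * (1 - min (g ?d) 1 + \<eta> ?d)"
      using key[of ?d 1] by (intro mult_left_mono u0) auto
    finally show "- f M \<le> prob_unif n k M * (1 - min (g ?d) 1 + \<eta> ?d)" .
    show "0 \<le> prob_unif n k M * (1 - min (g ?d) 1 + \<eta> ?d)"
      using \<eta>[of ?d] by (intro mult_nonneg_nonneg u0) auto
  qed
  also have "\<dots> = deg_avg n (k * n) (\<lambda>d. 1 - min (g d) 1) + deg_avg n (k * n) \<eta>"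
    by (simp only: sum_prob_unif_mult[OF n, where f="\<lambda>d. 1 - min (g d) 1 + \<eta> d"] deg_avg_add)
  finally show "dTV_X n k \<alpha> \<le> deg_avg n (k * n) (\<lambda>d. 1 - min (g d) 1) + deg_avg n (k * n) \<eta>" .
  have "deg_avg n (k * n) (\<lambda>d. max 0 (min (g d) (real m) - 1)) - real m * deg_avg n (k * n) \<eta>
      = (\<Sum>M\<in>kout_maps n k. prob_unif n k M * (max 0 (min (g (indeg n k M)) (real m) - 1) - real m * \<eta> (indeg n k M)))"
    by (simp only: sum_prob_unif_mult[OF n, where f="\<lambda>d. max 0 (min (g d) (real m) - 1) - real m * \<eta> d"]
        deg_avg_diff deg_avg_mult_left)
  also have "\<dots> \<le> dTV_X n k \<alpha>"
    unfolding dTV_X_eq f_def[symmetric]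
  \<comment> \<open>The test event is that the approximate ratio \<open>g\<close> exceeds one; it is
    an event about \<open>X\<close> because \<open>g\<close> is given by \<open>G\<close>.\<close>
  proof (rule half_sum_abs_ge[OF finite_kout_maps total, where A="\<lambda>x. G x > 1"])
    fix M assume M: "M \<in> kout_maps n k"
    let ?d = "indeg n k M"
    show "prob_unif n k M * (max 0 (min (g ?d) (real m) - 1) - real m * \<eta> ?d) \<le> (if G (Xstat n k M) > 1 then f M else 0)"
    proof (cases "g ?d > 1")
      case True
      then show ?thesis using key[of ?d m] m unfolding f[OF M] g[OF M, symmetric]
        by (auto intro!: mult_left_mono u0)
    next
      case False
      then have "max 0 (min (g ?d) (real m) - 1) = 0" by auto
      then show ?thesis using False \<eta>[of ?d] u0[of M] unfolding g[OF M, symmetric] by simp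
    qed
  qed
  finally show "deg_avg n (k * n) (\<lambda>d. max 0 (min (g d) (real m) - 1)) - real m * deg_avg n (k * n) \<eta> \<le> dTV_X n k \<alpha>" .
qed

text \<open>The linear terms of numerator and denominator combine to \<open>clt_stat\<close>, and
  the limits of their quadratic terms differ by \<open>\<theta>\<^sup>2 * k ^ 2 / 4\<close>. The
  second exponential collects the deviations from these limits and the cubic error of the
  denominator.\<close>

lemma lratio_ge_gaussian_tilt:
  fixes \<theta> :: real and n k :: nat
  assumes n: "n > 0" and \<theta>: "\<theta> > 0"
  defines "q \<equiv> (\<theta> / sqrt (real n))\<^sup>2 * (\<Sum>s<k*n. (real s)\<^sup>2) / (real n)\<^sup>2 / 2"
    and "r \<equiv> (\<theta> / sqrt (real n) / real n) ^ 3 * real (k * n) ^ 4 / 3"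
  shows "exp (\<theta> * clt_stat n k d - \<theta>\<^sup>2 * (real k)\<^sup>2 / 4)
      * exp (- (\<theta>\<^sup>2 / 2 * \<bar>lowsum 2 n d / real n - lowsum2_lim k\<bar> + (\<bar>q - \<theta>\<^sup>2 * real k ^ 3 / 6\<bar> + r)))
    \<le> lratio n k (1 / \<theta> * sqrt (real n)) d"
proof -
  define x where "x = \<theta> / sqrt (real n)"
  define D where "D = (\<Prod>s<k*n. 1 + (x / real n) * real s)"
  define \<mu> where "\<mu> = real ((k * n) choose 2) / real n"
  have x: "x \<ge> 0" using n \<theta> by (simp add: x_def)
  have D0: "D > 0" unfolding D_def using x by (intro prod_pos) (auto intro!: add_pos_nonneg)
  have "D \<le> exp ((x / real n) * real ((k * n) choose 2) - (x / real n)\<^sup>2 * (\<Sum>s<k*n. (real s)\<^sup>2) / 2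
      + (x / real n) ^ 3 * real (k * n) ^ 4 / 3)"
    unfolding D_def using x by (intro prod_one_plus_le_exp) simp
  also have "\<dots> = exp (x * \<mu> - q + r)" by (simp add: \<mu>_def q_def r_def x_def power_divide power_mult_distrib)
  finally have D: "D \<le> exp (x * \<mu> - q + r)" .
  have lr: "lratio n k (1 / \<theta> * sqrt (real n)) d = lowprod x n d / D"
    unfolding lratio_def D_def x_def by simp
  have clt: "\<theta> * clt_stat n k d = x * lowsum 1 n d - x * \<mu>"
    unfolding clt_stat_def x_def \<mu>_def using n by (simp add: field_simps)
  have x2: "x\<^sup>2 * lowsum 2 n d / 2 = \<theta>\<^sup>2 / 2 * (lowsum 2 n d / real n - lowsum2_lim k) + \<theta>\<^sup>2 / 2 * lowsum2_lim k"
    by (simp add: x_def power_divide algebra_simps)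
  have "\<theta>\<^sup>2 / 2 * (lowsum 2 n d / real n - lowsum2_lim k) \<le> \<theta>\<^sup>2 / 2 * \<bar>lowsum 2 n d / real n - lowsum2_lim k\<bar>"
    by (intro mult_left_mono) auto
  moreover have "\<theta>\<^sup>2 / 2 * lowsum2_lim k = \<theta>\<^sup>2 * real k ^ 3 / 6 + \<theta>\<^sup>2 * (real k)\<^sup>2 / 4"
    by (simp add: lowsum2_lim_def field_simps)
  ultimately have "(\<theta> * clt_stat n k d - \<theta>\<^sup>2 * (real k)\<^sup>2 / 4)
      + (- (\<theta>\<^sup>2 / 2 * \<bar>lowsum 2 n d / real n - lowsum2_lim k\<bar> + (\<bar>q - \<theta>\<^sup>2 * real k ^ 3 / 6\<bar> + r)))
    \<le> (x * lowsum 1 n d - x\<^sup>2 * lowsum 2 n d / 2) - (x * \<mu> - q + r)"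
    unfolding clt x2 by linarith
  then have "exp (\<theta> * clt_stat n k d - \<theta>\<^sup>2 * (real k)\<^sup>2 / 4)
      * exp (- (\<theta>\<^sup>2 / 2 * \<bar>lowsum 2 n d / real n - lowsum2_lim k\<bar> + (\<bar>q - \<theta>\<^sup>2 * real k ^ 3 / 6\<bar> + r)))
    \<le> exp (x * lowsum 1 n d - x\<^sup>2 * lowsum 2 n d / 2) / exp (x * \<mu> - q + r)"
    unfolding exp_add[symmetric] exp_diff[symmetric] by simp
  also have "\<dots> \<le> lowprod x n d / D"
    using D D0 lowprod_ge_exp[OF x, of n d] by (intro frac_le) (auto intro: order_trans[OF exp_ge_zero])
  finally show ?thesis unfolding lr .
qed

section \<open>Squeezing the total variation distance between Gaussian integrals\<close>

theorem theorem2: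
  fixes k :: nat and \<beta> :: real
  assumes "\<beta> > 0"
  shows "(\<lambda>n. dTV_X n k (\<beta> * sqrt (real n))) \<longlonglongrightarrow>
    (1/2) * (LINT z|lborel. std_normal_density z *
       \<bar>1 - exp (- (real k ^ 2 / (4 * \<beta>^2) + sqrt (real k ^ 2 / (2 * \<beta>^2)) * z))\<bar>)"
proof -
  define \<theta> where "\<theta> = 1 / \<beta>"
  \<comment> \<open>The standard deviation of the Gaussian in the statement, whose mean is
    \<open>\<tau>\<^sup>2 / 2\<close>.\<close>
  define \<tau> where "\<tau> = \<theta> * (real k / sqrt 2)"
  define J where "J = (\<lambda>z. exp (- (\<tau>\<^sup>2 / 2 + \<tau> * z)))"
  define I where "I = (LINT z|lborel. std_normal_density z * \<bar>1 - J z\<bar>)"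
  define G where "G = (\<lambda>y. exp (\<theta> * y - \<theta>\<^sup>2 * (real k)\<^sup>2 / 4))"
  have \<theta>: "\<theta> > 0" using assms by (simp add: \<theta>_def)
  have \<beta>: "\<beta> = 1 / \<theta>" by (simp add: \<theta>_def)
  have \<tau>2: "\<tau>\<^sup>2 / 2 = \<theta>\<^sup>2 * (real k)\<^sup>2 / 4" by (simp add: \<tau>_def power_mult_distrib power_divide)
  have "sqrt (real k ^ 2 / (2 * \<beta>^2)) = \<tau>"
    using assms by (simp add: \<tau>_def \<theta>_def real_sqrt_divide real_sqrt_mult)
  moreover have "real k ^ 2 / (4 * \<beta>^2) = \<tau>\<^sup>2 / 2"
    unfolding \<tau>2 by (simp add: \<theta>_def power_divide)
  ultimately have goal: "(LINT z|lborel. std_normal_density z *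
       \<bar>1 - exp (- (real k ^ 2 / (4 * \<beta>^2) + sqrt (real k ^ 2 / (2 * \<beta>^2)) * z))\<bar>) = I"
    unfolding I_def J_def by (simp only:)
  have GJ: "G (- (real k / sqrt 2 * z)) = J z" for z
    unfolding G_def J_def \<tau>2 by (simp add: \<tau>_def)
  have contG: "isCont G y" for y unfolding G_def by (intro continuous_intros)
  have G0: "G y > 0" for y by (simp add: G_def)

  \<comment> \<open>The deterministic part of the error: deviation of the quadratic term of the
    denominator and its cubic term.\<close>
  define e where "e = (\<lambda>n. \<bar>(\<theta> / sqrt (real n))\<^sup>2 * (\<Sum>s<k*n. (real s)\<^sup>2) / (real n)\<^sup>2 / 2 - \<theta>\<^sup>2 * real k ^ 3 / 6\<bar>
      + (\<theta> / sqrt (real n) / real n) ^ 3 * real (k * n) ^ 4 / 3)"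
  define \<eta> where "\<eta> = (\<lambda>n d. \<theta>\<^sup>2 / 2 * \<bar>lowsum 2 n d / real n - lowsum2_lim k\<bar> + e n)"
  define err where "err = (\<lambda>n. deg_avg n (k * n) (\<eta> n))"
  have \<eta>0: "\<eta> n d \<ge> 0" for n d using \<theta> by (simp add: \<eta>_def e_def)
  have "(\<lambda>n. (\<theta> / sqrt (real n) / real n) ^ 3 * (real k * real n) ^ 4 / 3) \<longlonglongrightarrow> 0"
    using \<theta> by (cases "k = 0") (simp_all, real_asymp)
  then have "(\<lambda>n. (\<theta> / sqrt (real n) / real n) ^ 3 * real (k * n) ^ 4 / 3) \<longlonglongrightarrow> 0"
    by simp
  from tendsto_add[OF tendsto_rabs_zero[OF LIM_zero[OF tendsto_scaled_sum_squares[of \<theta> k]]] this]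
  have e: "e \<longlonglongrightarrow> 0" unfolding e_def by simp
  have "(\<lambda>n. \<theta>\<^sup>2 / 2 * deg_avg n (k * n) (\<lambda>d. \<bar>lowsum 2 n d / real n - lowsum2_lim k\<bar>) + e n) \<longlonglongrightarrow> \<theta>\<^sup>2 / 2 * 0 + 0"
    by (intro tendsto_intros tendsto_deg_avg_lowsum_2 e)
  then have "(\<lambda>n. \<theta>\<^sup>2 / 2 * deg_avg n (k * n) (\<lambda>d. \<bar>lowsum 2 n d / real n - lowsum2_lim k\<bar>) + e n) \<longlonglongrightarrow> 0"
    by simp
  then have err: "err \<longlonglongrightarrow> 0"
  proof (rule Lim_transform_eventually)
    show "\<forall>\<^sub>F n in sequentially. \<theta>\<^sup>2 / 2 * deg_avg n (k * n) (\<lambda>d. \<bar>lowsum 2 n d / real n - lowsum2_lim k\<bar>) + e n = err n"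
      using eventually_gt_at_top[of 0]
      by eventually_elim (simp only: err_def \<eta>_def deg_avg_add deg_avg_mult_left deg_avg_const)
  qed

  define U where "U = (\<lambda>n. deg_avg n (k * n) (\<lambda>d. 1 - min (G (clt_stat n k d)) 1) + err n)"
  define V where "V = (\<lambda>m n. deg_avg n (k * n) (\<lambda>d. max 0 (min (G (clt_stat n k d)) (real m) - 1)) - real m * err n)"
  have upper: "dTV_X n k (\<beta> * sqrt (real n)) \<le> U n"
    and lower: "m \<ge> 1 \<Longrightarrow> V m n \<le> dTV_X n k (\<beta> * sqrt (real n))" if n: "n > 0" for n m
  proof -
    \<comment> \<open>\<open>G\<close> of the centred statistic, recovered from a value
      \<open>x\<close> of \<open>X\<close>.\<close>
    define H where "H = (\<lambda>x. G (((real x - real (k * n)) / 2 - real ((k * n) choose 2) / real n) / sqrt (real n)))"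
    have \<alpha>: "\<beta> * sqrt (real n) > 0" using assms n by simp
    have H: "G (clt_stat n k (indeg n k M)) = H (Xstat n k M)" if "M \<in> kout_maps n k" for M
      unfolding H_def clt_stat_indeg[OF that] ..
    have L: "G (clt_stat n k d) * exp (- \<eta> n d) \<le> lratio n k (\<beta> * sqrt (real n)) d" for d
      using lratio_ge_gaussian_tilt[OF n \<theta>, of k d] unfolding G_def \<eta>_def e_def \<beta> .
    note bounds = dTV_X_bounds[OF n \<alpha> _ H G0 \<eta>0 L]
    show "dTV_X n k (\<beta> * sqrt (real n)) \<le> U n"
      unfolding U_def err_def using bounds(1)[of 1] by simp
    show "V m n \<le> dTV_X n k (\<beta> * sqrt (real n))" if "m \<ge> 1"
      unfolding V_def err_def using bounds(2)[OF that] .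
  qed
  have lim_U: "(\<lambda>n. deg_avg n (k * n) (\<lambda>d. 1 - min (G (clt_stat n k d)) 1))
      \<longlonglongrightarrow> (LINT z|lborel. std_normal_density z * (1 - min (G (- (real k / sqrt 2 * z))) 1))"
  proof (rule tendsto_deg_avg_bounded_continuous[where B=1])
    show "\<bar>1 - min (G y) 1\<bar> \<le> 1" for y using G0[of y] by auto
  qed (intro continuous_intros contG)
  have mean_J: "(LINT z|lborel. std_normal_density z * (1 - min (J z) 1)) = I / 2"
    unfolding I_def J_def by (rule std_normal_tilt_half_abs(1))
  from tendsto_add[OF lim_U err] have "U \<longlonglongrightarrow> I / 2"
    unfolding U_def GJ mean_J by simp
  moreover have V: "V m \<longlonglongrightarrow> (LINT z|lborel. std_normal_density z * max 0 (min (J z) (real m) - 1))" for m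
  proof -
    have "(\<lambda>n. deg_avg n (k * n) (\<lambda>d. max 0 (min (G (clt_stat n k d)) (real m) - 1)))
      \<longlonglongrightarrow> (LINT z|lborel. std_normal_density z * max 0 (min (G (- (real k / sqrt 2 * z))) (real m) - 1))"
      by (rule tendsto_deg_avg_bounded_continuous[where B="real m"])
         (auto intro!: continuous_intros contG)
    from tendsto_diff[OF this tendsto_mult[OF tendsto_const[of "real m"] err]] show ?thesis
      unfolding V_def GJ by simp
  qed
  ultimately have "(\<lambda>n. dTV_X n k (\<beta> * sqrt (real n))) \<longlonglongrightarrow> I / 2"
  proof (intro order_tendstoI)
    fix a assume "I / 2 < a"
    with \<open>U \<longlonglongrightarrow> I / 2\<close> have "\<forall>\<^sub>F n in sequentially. U n < a" by (rule order_tendstoD)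
    then show "\<forall>\<^sub>F n in sequentially. dTV_X n k (\<beta> * sqrt (real n)) < a"
      using eventually_gt_at_top[of 0] by eventually_elim (rule le_less_trans[OF upper])
  next
    \<comment> \<open>The error in \<open>V m n\<close> carries the factor \<open>m\<close>, so
      \<open>m\<close> is fixed first, with its truncated integral above \<open>a\<close>, and only
      then does \<open>n\<close> tend to infinity.\<close>
    fix a assume "a < I / 2"
    then have "\<forall>\<^sub>F m in sequentially. a < (LINT z|lborel. std_normal_density z * max 0 (min (J z) (real m) - 1))"
      using std_normal_tilt_half_abs(2)[of \<tau>] unfolding I_def J_def by (intro order_tendstoD(1))
    then have "\<forall>\<^sub>F m in sequentially. a < (LINT z|lborel. std_normal_density z * max 0 (min (J z) (real m) - 1)) \<and> m \<ge> 1"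
      using eventually_ge_at_top[of 1] by (rule eventually_conj)
    then obtain m where m: "a < (LINT z|lborel. std_normal_density z * max 0 (min (J z) (real m) - 1))" "m \<ge> 1"
      by (auto dest!: eventually_happens)
    from order_tendstoD(1)[OF V m(1)] have "\<forall>\<^sub>F n in sequentially. a < V m n" .
    then show "\<forall>\<^sub>F n in sequentially. a < dTV_X n k (\<beta> * sqrt (real n))"
      using eventually_gt_at_top[of 0] by eventually_elim (rule less_le_trans[OF _ lower[OF _ m(2)]])
  qed
  then show ?thesis unfolding goal by simp
qed

end
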